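(* For each nonnegative integer $m$, the coefficient of $t^m$ in $$F(t,s;u)=1+\sum_{n\geq 2}\Bigl(\sum_{\pi\in\mathcal{D}_n}t^{\mathrm{des}(\pi)}s^{\mathrm{xdes}(\pi)}\Bigr)u^n$$ is a rational fraction in $s$ and $u$.
   Context: $\mathcal{D}_n$ denotes the set of derangements of $[n]=\{1,\dots,n\}$ (permutations without fixed points). For a permutation $\pi=\pi_1\cdots\pi_n$, $\mathrm{des}(\pi)=|\{i\in[n-1]:\pi_i>\pi_{i+1}\}|$, and an index $i$ is a crossing descent if $\pi_i\ge i+1\ge\pi_{i+1}$; $\mathrm{xdes}(\pi)$ is the number of crossing descents of $\pi$. *)

theory Defs
  imports "HOL-Combinatorics.Permutations" "HOL-Computational_Algebra.Polynomial_FPS"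
begin

definition derangements :: "nat \<Rightarrow> (nat \<Rightarrow> nat) set" where
  "derangements n = {p. p permutes {1..n} \<and> (\<forall>i\<in>{1..n}. p i \<noteq> i)}"

definition des :: "nat \<Rightarrow> (nat \<Rightarrow> nat) \<Rightarrow> nat" where
  "des n p = card {i\<in>{1..<n}. p i > p (Suc i)}"

definition xdes :: "nat \<Rightarrow> (nat \<Rightarrow> nat) \<Rightarrow> nat" where
  "xdes n p = card {i\<in>{1..<n}. p i \<ge> Suc i \<and> Suc i \<ge> p (Suc i)}"

text \<open>Coefficient of t^m in F(t,s;u), as a formal power series in u whose
  coefficients are polynomials in s (integer coefficients).\<close>
definition F_coeff :: "nat \<Rightarrow> int poly fps" where
  "F_coeff m = Abs_fps (\<lambda>n. if n = 0 then (if m = 0 then 1 else 0)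
      else if n < 2 then 0
      else (\<Sum>p\<in>{p\<in>derangements n. des n p = m}. monom 1 (xdes n p)))"

definition rational_fraction_su :: "int poly fps \<Rightarrow> bool" where
  "rational_fraction_su G \<longleftrightarrow>
     (\<exists>P Q :: int poly poly. Q \<noteq> 0 \<and> fps_of_poly Q * G = fps_of_poly P)"

end

theory Submission
  imports Defs "HOL-Library.Infinite_Set"
begin

text \<open>
  Cut a derangement \<open>\<pi>\<close> at its descents and at the ascents \<open>i\<close> with \<open>\<pi>(i) < i\<close> and \<open>\<pi>(i+1) > i+1\<close>. The number of
  these breaks is \<open>des \<pi> + xdes \<pi> - 1\<close>, because the position signs (excedance or not) start
  positive and end negative and the crossing descents are the changes from positive to negative.
  Consider pairs of a derangement with \<open>xdes = k\<close> and a composition of \<open>n\<close> into \<open>m + k\<close> parts whose cut set contains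
  all breaks. Summing over derangements first gives
  \<open>\<Sum>j\<le>m. a\<^sub>j(n) * binomial (n - j - k) (m - j)\<close>, where \<open>a\<^sub>j(n)\<close> counts the derangements with \<open>des = j\<close>; the term
  \<open>j = m\<close> is \<open>a\<^sub>m(n)\<close>. Rational series are closed under multiplication of the coefficients by
  polynomials in \<open>n\<close>, so induction on \<open>m\<close> reduces the claim to the pairs.

  In a pair the permutation increases on each segment and each segment has one sign. It is encoded
  by the word listing, for each value, the segment of its position: segment \<open>b\<close> of the word may only
  contain \<open>b\<close>, positive letters below \<open>b\<close> and negative letters above \<open>b\<close>, and must not begin (positive \<open>b\<close>) or
  end (negative \<open>b\<close>) with \<open>b\<close>; moreover each letter occurs as often as its segment is long. Such balanced
  words have a rational generating function.
\<close>

section \<open>Rational series\<close>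

lemma rational_fraction_suI:
  "Q \<noteq> 0 \<Longrightarrow> fps_of_poly Q * G = fps_of_poly P \<Longrightarrow> rational_fraction_su G"
  by (auto simp: rational_fraction_su_def)

lemma rational_fraction_suE:
  assumes "rational_fraction_su G"
  obtains P Q :: "int poly poly" where "Q \<noteq> 0" "fps_of_poly Q * G = fps_of_poly P"
  using assms by (auto simp: rational_fraction_su_def)

lemma rational_of_poly: "rational_fraction_su (fps_of_poly P)"
  by (rule rational_fraction_suI[of 1 _ P]) auto

lemma rational_0 [simp]: "rational_fraction_su 0"
  using rational_of_poly[of 0] by simp

lemma rational_1 [simp]: "rational_fraction_su 1"
  using rational_of_poly[of 1] by simp

lemma rational_X [simp]: "rational_fraction_su fps_X"
  using rational_of_poly[of "[:0, 1:]"] by simp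

lemma rational_const [simp]: "rational_fraction_su (fps_const c)"
  using rational_of_poly[of "[:c:]"] by (simp add: fps_of_poly_const)

lemma rational_add:
  assumes "rational_fraction_su G" "rational_fraction_su H"
  shows "rational_fraction_su (G + H)"
proof -
  obtain P Q where G: "Q \<noteq> 0" "fps_of_poly Q * G = fps_of_poly P"
    using assms(1) by (rule rational_fraction_suE)
  obtain P' Q' where H: "Q' \<noteq> 0" "fps_of_poly Q' * H = fps_of_poly P'"
    using assms(2) by (rule rational_fraction_suE)
  have "fps_of_poly (Q * Q') * (G + H) =
      fps_of_poly Q' * (fps_of_poly Q * G) + fps_of_poly Q * (fps_of_poly Q' * H)"
    by (simp add: fps_of_poly_mult algebra_simps)
  also have "\<dots> = fps_of_poly (Q' * P + Q * P')"
    by (simp only: G H fps_of_poly_mult fps_of_poly_add)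
  finally show ?thesis using G H by (intro rational_fraction_suI[of "Q * Q'"]) auto
qed

lemma rational_mult:
  assumes "rational_fraction_su G" "rational_fraction_su H"
  shows "rational_fraction_su (G * H)"
proof -
  obtain P Q where G: "Q \<noteq> 0" "fps_of_poly Q * G = fps_of_poly P"
    using assms(1) by (rule rational_fraction_suE)
  obtain P' Q' where H: "Q' \<noteq> 0" "fps_of_poly Q' * H = fps_of_poly P'"
    using assms(2) by (rule rational_fraction_suE)
  have "fps_of_poly (Q * Q') * (G * H) = (fps_of_poly Q * G) * (fps_of_poly Q' * H)"
    by (simp add: fps_of_poly_mult algebra_simps)
  also have "\<dots> = fps_of_poly (P * P')"
    by (simp only: G H fps_of_poly_mult)
  finally show ?thesis using G H by (intro rational_fraction_suI[of "Q * Q'"]) auto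
qed

lemma rational_diff:
  assumes "rational_fraction_su G" "rational_fraction_su H"
  shows "rational_fraction_su (G - H)"
proof -
  have "rational_fraction_su (G + fps_const (-1) * H)"
    using assms by (intro rational_add rational_mult) auto
  also have "G + fps_const (-1) * H = G - H"
    by (simp add: fps_const_neg[symmetric] del: fps_const_neg)
  finally show ?thesis .
qed

lemma rational_sum:
  "(\<And>x. x \<in> A \<Longrightarrow> rational_fraction_su (f x)) \<Longrightarrow> rational_fraction_su (\<Sum>x\<in>A. f x)"
  by (induction A rule: infinite_finite_induct) (auto intro: rational_add)

text \<open>From \<open>Q * K = P\<close> and \<open>Q' * (K * G) = P'\<close> follows
  \<open>(Q' * P) * G = Q * P'\<close>, and \<open>P\<close> is nonzero because \<open>K\<close> is.
  This replaces every division below, since \<open>K\<close> need not be invertible as a power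
  series over \<open>int poly\<close>.\<close>

lemma rational_cancel:
  assumes "rational_fraction_su K" "K \<noteq> 0" "rational_fraction_su (K * G)"
  shows "rational_fraction_su G"
proof -
  obtain P Q where K: "Q \<noteq> 0" "fps_of_poly Q * K = fps_of_poly P"
    using assms(1) by (rule rational_fraction_suE)
  obtain P' Q' where KG: "Q' \<noteq> 0" "fps_of_poly Q' * (K * G) = fps_of_poly P'"
    using assms(3) by (rule rational_fraction_suE)
  have "fps_of_poly P \<noteq> 0"
    unfolding K(2)[symmetric] using K(1) assms(2) fps_of_poly_eq_iff[of Q 0] by simp
  hence "P \<noteq> 0" by auto
  have "fps_of_poly (Q' * P) * G = fps_of_poly Q * (fps_of_poly Q' * (K * G))"
    unfolding fps_of_poly_mult K(2)[symmetric] by (simp add: algebra_simps)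
  also have "\<dots> = fps_of_poly (Q * P')" by (simp only: KG fps_of_poly_mult)
  finally show ?thesis using KG(1) \<open>P \<noteq> 0\<close> by (intro rational_fraction_suI[of "Q' * P"]) auto
qed

text \<open>Differentiating \<open>Q * G = P\<close> leaves \<open>Q * G' = P' - Q' * G\<close>; the
  right side is rational because \<open>G\<close> is, and \<open>Q\<close> cancels.\<close>

lemma rational_deriv:
  assumes "rational_fraction_su G"
  shows "rational_fraction_su (fps_deriv G)"
proof -
  obtain P Q where G: "Q \<noteq> 0" "fps_of_poly Q * G = fps_of_poly P"
    using assms by (rule rational_fraction_suE)
  have "fps_deriv (fps_of_poly Q * G) = fps_of_poly (pderiv P)"
    by (simp add: G(2) fps_of_poly_pderiv)
  hence "fps_of_poly Q * fps_deriv G = fps_of_poly (pderiv P) - fps_of_poly (pderiv Q) * G"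
    by (simp add: fps_of_poly_pderiv algebra_simps)
  moreover have "rational_fraction_su \<dots>"
    using assms by (intro rational_diff rational_mult rational_of_poly)
  moreover have "fps_of_poly Q \<noteq> 0" using G(1) fps_of_poly_eq_iff[of Q 0] by simp
  ultimately show ?thesis using rational_cancel rational_of_poly by metis
qed

text \<open>The operator \<open>fps_X * fps_deriv\<close> multiplies the coefficient at
  \<open>n\<close> by \<open>n\<close>.\<close>

lemma rational_mult_linear:
  assumes "rational_fraction_su (Abs_fps g)"
  shows "rational_fraction_su (Abs_fps (\<lambda>n. of_int (int n - z) * g n))"
proof -
  have "rational_fraction_su (fps_X * fps_deriv (Abs_fps g) - fps_const (of_int z) * Abs_fps g)"
    using assms by (intro rational_diff rational_mult rational_deriv) auto
  also have "fps_X * fps_deriv (Abs_fps g) - fps_const (of_int z) * Abs_fps g =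
      Abs_fps (\<lambda>n. of_int (int n - z) * g n)"
    by (rule fps_ext) (simp add: algebra_simps del: of_nat_Suc)
  finally show ?thesis .
qed

text \<open>Induction on \<open>d\<close>: the identity
  \<open>Suc d * (N choose Suc d) = (N - d) * (N choose d)\<close> turns the step into a linear
  factor, and the constant \<open>Suc d\<close> is cancelled. As \<open>g\<close> vanishes below
  \<open>z\<close>, the truncated \<open>n - z\<close> agrees with the integer difference wherever
  it matters.\<close>

lemma rational_mult_binomial:
  assumes "rational_fraction_su (Abs_fps g)" "\<And>n. n < z \<Longrightarrow> g n = 0"
  shows "rational_fraction_su (Abs_fps (\<lambda>n. of_nat ((n - z) choose d) * g n))"
proof (induction d)
  case 0
  show ?case using assms(1) by simp
next
  case (Suc d)
  have *: "of_nat (Suc d) * (of_nat ((n - z) choose Suc d) * g n) =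
      of_int (int n - int (z + d)) * (of_nat ((n - z) choose d) * g n)" for n
  proof (cases "n < z")
    case False
    \<comment> \<open>For \<open>n - z < d\<close> the truncated \<open>n - z - d\<close> differs
      from the integer, but then both binomials are zero.\<close>
    have "int (Suc d * ((n - z) choose Suc d)) = (int n - int (z + d)) * int ((n - z) choose d)"
    proof (cases "n - z < d")
      case True
      then show ?thesis by (simp add: binomial_eq_0)
    next
      case F2: False
      have "Suc d * ((n - z) choose Suc d) = (n - z - d) * ((n - z) choose d)"
        by (metis binomial_absorb_comp binomial_absorption)
      moreover have "int n - int (z + d) = int (n - z - d)" using False F2 by simp
      ultimately show ?thesis by (simp only: of_nat_mult)
    qed
    hence "(of_int (int (Suc d * ((n - z) choose Suc d))) :: int poly) =
        of_int ((int n - int (z + d)) * int ((n - z) choose d))" by (rule arg_cong)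
    hence "(of_nat (Suc d) * of_nat ((n - z) choose Suc d) :: int poly) =
        of_int (int n - int (z + d)) * of_nat ((n - z) choose d)"
      by (simp only: of_int_mult of_int_of_nat_eq of_nat_mult)
    thus ?thesis by (simp only: mult.assoc[symmetric])
  qed (use assms(2) in auto)
  have "rational_fraction_su (fps_const (of_nat (Suc d)) *
      Abs_fps (\<lambda>n. of_nat ((n - z) choose Suc d) * g n))"
  proof (rule back_subst[of rational_fraction_su])
    show "rational_fraction_su (Abs_fps (\<lambda>n. of_int (int n - int (z + d)) *
        (of_nat ((n - z) choose d) * g n)))"
      by (rule rational_mult_linear[OF Suc])
    show "Abs_fps (\<lambda>n. of_int (int n - int (z + d)) * (of_nat ((n - z) choose d) * g n)) =
        fps_const (of_nat (Suc d)) * Abs_fps (\<lambda>n. of_nat ((n - z) choose Suc d) * g n)"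
      by (rule fps_ext) (simp only: fps_mult_left_const_nth fps_nth_Abs_fps *)
  qed
  moreover have "fps_const (of_nat (Suc d) :: int poly) \<noteq> 0"
    by (metis fps_const_eq_0_iff of_nat_eq_0_iff nat.distinct(1))
  ultimately show ?case using rational_cancel rational_const by blast
qed

text \<open>Gaussian elimination of the unknown \<open>x p\<close>. The constant terms of the matrix
  form the identity, so the pivot \<open>K p p\<close> is nonzero and can be cancelled.\<close>

lemma rational_linear_system:
  assumes "finite A"
    and "\<And>q a. q \<in> A \<Longrightarrow> a \<in> A \<Longrightarrow> rational_fraction_su (K q a)"
    and "\<And>q a. q \<in> A \<Longrightarrow> a \<in> A \<Longrightarrow> fps_nth (K q a) 0 = (if q = a then 1 else 0)"
    and "\<And>q. q \<in> A \<Longrightarrow> rational_fraction_su (r q)"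
    and "\<And>q. q \<in> A \<Longrightarrow> (\<Sum>a\<in>A. K q a * x a) = r q"
  shows "\<forall>q\<in>A. rational_fraction_su (x q)"
  using assms
proof (induction A arbitrary: K r rule: finite_induct)
  case (insert p A)
  \<comment> \<open>Row \<open>p\<close> is eliminated by cross-multiplication, without division.
    The constant terms of \<open>K'\<close> again form the identity, because that of
    \<open>K q p\<close> is 0 for \<open>q \<noteq> p\<close>.\<close>
  define K' where "K' = (\<lambda>q a. K p p * K q a - K q p * K p a)"
  define r' where "r' = (\<lambda>q. K p p * r q - K q p * r p)"
  have "\<forall>q\<in>A. rational_fraction_su (x q)"
  proof (rule insert.IH[of K' r'])
    fix q assume q: "q \<in> A"
    show "rational_fraction_su (r' q)"
      unfolding r'_def using q by (intro rational_diff rational_mult insert.prems) auto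
    have "(\<Sum>a\<in>A. K' q a * x a) =
        K p p * (\<Sum>a\<in>A. K q a * x a) - K q p * (\<Sum>a\<in>A. K p a * x a)"
      by (simp add: K'_def sum_distrib_left algebra_simps sum_subtractf)
    also have "(\<Sum>a\<in>A. K q a * x a) = r q - K q p * x p"
      using insert.prems(4)[of q] q insert.hyps by (simp add: algebra_simps)
    also have "(\<Sum>a\<in>A. K p a * x a) = r p - K p p * x p"
      using insert.prems(4)[of p] insert.hyps by (simp add: algebra_simps)
    finally show "(\<Sum>a\<in>A. K' q a * x a) = r' q" by (simp add: r'_def algebra_simps)
    fix a assume a: "a \<in> A"
    show "rational_fraction_su (K' q a)"
      unfolding K'_def using q a by (intro rational_diff rational_mult insert.prems) auto
    show "fps_nth (K' q a) 0 = (if q = a then 1 else 0)"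
      using q a insert.hyps by (auto simp: K'_def insert.prems)
  qed
  moreover have "rational_fraction_su (x p)"
  proof (rule rational_cancel[of "K p p"])
    have "fps_nth (K p p) 0 = 1" by (simp add: insert.prems)
    thus "K p p \<noteq> 0" by auto
    have eq: "K p p * x p = r p - (\<Sum>a\<in>A. K p a * x a)"
      using insert.prems(4)[of p] insert.hyps by (simp add: algebra_simps)
    show "rational_fraction_su (K p p * x p)"
      unfolding eq using insert.prems \<open>\<forall>q\<in>A. rational_fraction_su (x q)\<close>
      by (intro rational_diff rational_sum rational_mult) auto
  qed (simp add: insert.prems)
  ultimately show ?case by simp
qed simp

section \<open>Balanced words\<close>

definition slots :: "('a \<Rightarrow> nat) \<Rightarrow> ('a \<times> nat) set" where
  "slots d = (SIGMA b:UNIV. {..<d b})"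

text \<open>Words \<open>w\<close> cut into blocks, the block \<open>b\<close> having \<open>d b\<close> slots, with \<open>c a\<close> occurrences of each letter \<open>a\<close>.
  Slot \<open>0\<close> of a block is the end at which the letter of the block is forbidden; this
  excludes fixed points.\<close>

definition fillings :: "('a \<Rightarrow> 'a \<Rightarrow> bool) \<Rightarrow> ('a \<Rightarrow> nat) \<Rightarrow> ('a \<Rightarrow> nat) \<Rightarrow> ('a \<times> nat \<Rightarrow> 'a) set" where
  "fillings R d c = {w \<in> extensional (slots d).
     (\<forall>a. card {x \<in> slots d. w x = a} = c a) \<and>
     (\<forall>x\<in>slots d. R (w x) (fst x) \<and> (snd x = 0 \<longrightarrow> w x \<noteq> fst x))}"

definition vectors :: "'a set \<Rightarrow> nat \<Rightarrow> ('a \<Rightarrow> nat) set" where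
  "vectors A n = {c. (\<forall>a. a \<notin> A \<longrightarrow> c a = 0) \<and> sum c A = n}"

definition balanced :: "('a \<Rightarrow> 'a \<Rightarrow> bool) \<Rightarrow> 'a set \<Rightarrow> nat \<Rightarrow> nat" where
  "balanced R A n = (\<Sum>c\<in>vectors A n. card (fillings R c c))"

lemma finite_slots:
  assumes "finite A" "\<And>a. a \<notin> A \<Longrightarrow> d a = 0"
  shows "finite (slots d)"
proof (rule finite_subset)
  show "slots d \<subseteq> (SIGMA b:A. {..<d b})"
    using assms(2) by (force simp: slots_def)
qed (use assms in auto)

lemma finite_fillings:
  assumes "finite A" "\<And>a. a \<notin> A \<Longrightarrow> d a = 0" "\<And>a. a \<notin> A \<Longrightarrow> c a = 0"
  shows "finite (fillings R d c)"
proof (rule finite_subset)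
  have fin: "finite (slots d)" using finite_slots assms by metis
  show "fillings R d c \<subseteq> slots d \<rightarrow>\<^sub>E A"
  proof
    fix w assume w: "w \<in> fillings R d c"
    have "w x \<in> A" if x: "x \<in> slots d" for x
    proof (rule ccontr)
      assume "w x \<notin> A"
      hence "card {y \<in> slots d. w y = w x} = 0" using w assms(3) by (auto simp: fillings_def)
      moreover have "x \<in> {y \<in> slots d. w y = w x}" using x by simp
      moreover have "finite {y \<in> slots d. w y = w x}" using fin by simp
      ultimately show False using card_0_eq by blast
    qed
    thus "w \<in> slots d \<rightarrow>\<^sub>E A" using w by (auto simp: fillings_def PiE_def)
  qed
  show "finite (slots d \<rightarrow>\<^sub>E A)" using fin assms(1) by (intro finite_PiE) auto
qed

lemma finite_vectors: "finite A \<Longrightarrow> finite (vectors A n)"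
proof -
  assume A: "finite A"
  have "vectors A n \<subseteq> {f. \<forall>x. (x \<in> A \<longrightarrow> f x \<in> {..n}) \<and> (x \<notin> A \<longrightarrow> f x = 0)}"
    using A by (auto simp: vectors_def intro!: member_le_sum)
  thus ?thesis by (rule finite_subset) (use A finite_set_of_finite_funs[of A "{..n}" 0] in simp)
qed

text \<open>Condition on the letter \<open>a\<close> in the additional last slot of block
  \<open>q\<close>: deleting this slot leaves a filling with one \<open>a\<close> fewer. The letter
  \<open>q\<close> itself is excluded if the new slot is slot 0.\<close>

lemma card_fillings_Suc:
  assumes A: "finite A" "q \<in> A"
    and d: "\<And>a. a \<notin> A \<Longrightarrow> d a = 0" and c: "\<And>a. a \<notin> A \<Longrightarrow> c a = 0"
  shows "card (fillings R (d(q := Suc (d q))) c) =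
    (\<Sum>a\<in>{a\<in>A. c a > 0 \<and> R a q \<and> \<not> (d q = 0 \<and> a = q)}. card (fillings R d (c(a := c a - 1))))"
proof -
  define x0 where "x0 = (q, d q)"
  define F where "F = fillings R (d(q := Suc (d q))) c"
  define I where "I = {a\<in>A. c a > 0 \<and> R a q \<and> \<not> (d q = 0 \<and> a = q)}"
  have slots: "slots (d(q := Suc (d q))) = insert x0 (slots d)"
    by (auto simp: slots_def x0_def split: if_splits)
  have x0: "x0 \<notin> slots d" "fst x0 = q" "snd x0 = d q" by (auto simp: slots_def x0_def)
  have fin: "finite (slots d)" using finite_slots A d by metis
  have "finite F" unfolding F_def by (rule finite_fillings[of A]) (use assms in auto)
  have count: "card {x \<in> insert x0 (slots d). w x = a} =
      card {x \<in> slots d. w x = a} + (if w x0 = a then 1 else 0)" for w :: "'a \<times> nat \<Rightarrow> 'a" and a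
  proof (cases "w x0 = a")
    case True
    hence "{x \<in> insert x0 (slots d). w x = a} = insert x0 {x \<in> slots d. w x = a}" by auto
    thus ?thesis using True fin x0 by simp
  next
    case False
    hence "{x \<in> insert x0 (slots d). w x = a} = {x \<in> slots d. w x = a}" by auto
    thus ?thesis using False by simp
  qed
  have count_upd: "{x \<in> slots d. (w(x0 := y)) x = a} = {x \<in> slots d. w x = a}"
    for w :: "'a \<times> nat \<Rightarrow> 'a" and a y
    using x0 by auto
  have F: "w \<in> F \<longleftrightarrow> w \<in> extensional (insert x0 (slots d)) \<and>
      (\<forall>a. card {x \<in> slots d. w x = a} + (if w x0 = a then 1 else 0) = c a) \<and>
      (\<forall>x\<in>slots d. R (w x) (fst x) \<and> (snd x = 0 \<longrightarrow> w x \<noteq> fst x)) \<and>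
      R (w x0) q \<and> (d q = 0 \<longrightarrow> w x0 \<noteq> q)" for w
    unfolding F_def fillings_def slots mem_Collect_eq count using x0 by auto
  have in_I: "w x0 \<in> I" if "w \<in> F" for w
  proof -
    have "card {x \<in> slots d. w x = w x0} + 1 = c (w x0)"
      using that unfolding F by (auto dest: spec[of _ "w x0"])
    hence "c (w x0) > 0" by linarith
    moreover from this have "w x0 \<in> A" using c by (metis less_irrefl)
    ultimately show ?thesis using that unfolding F I_def by auto
  qed
  have "card F = card (\<Union>a\<in>I. {w\<in>F. w x0 = a})"
    using in_I by (intro arg_cong[of _ _ card]) auto
  also have "\<dots> = (\<Sum>a\<in>I. card {w\<in>F. w x0 = a})"
    using A \<open>finite F\<close> by (intro card_UN_disjoint) (auto simp: I_def)
  also have "\<dots> = (\<Sum>a\<in>I. card (fillings R d (c(a := c a - 1))))"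
  proof (rule sum.cong)
    fix a assume a: "a \<in> I"
    \<comment> \<open>Fillings are extensional, so the inverse map resets the removed slot to
      \<open>undefined\<close>.\<close>
    have "bij_betw (\<lambda>w. w(x0 := a)) (fillings R d (c(a := c a - 1))) {w\<in>F. w x0 = a}"
    proof (rule bij_betw_byWitness[where f' = "\<lambda>w. w(x0 := undefined)"])
      show "\<forall>w\<in>fillings R d (c(a := c a - 1)). (w(x0 := a))(x0 := undefined) = w"
        using x0 by (auto simp: fillings_def extensional_def fun_eq_iff)
      show "\<forall>w\<in>{w\<in>F. w x0 = a}. (w(x0 := undefined))(x0 := a) = w"
        by (auto simp: fun_eq_iff)
      show "(\<lambda>w. w(x0 := a)) ` fillings R d (c(a := c a - 1)) \<subseteq> {w\<in>F. w x0 = a}"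
      proof (intro subsetI, elim imageE)
        fix w v assume w: "w \<in> fillings R d (c(a := c a - 1))" and v: "v = w(x0 := a)"
        have "v \<in> F" unfolding F v count_upd
        proof (intro conjI allI ballI impI)
          show "w(x0 := a) \<in> extensional (insert x0 (slots d))"
            using w by (auto simp: fillings_def extensional_def)
          show "card {x \<in> slots d. w x = b} + (if (w(x0 := a)) x0 = b then 1 else 0) = c b" for b
            using w a by (auto simp: fillings_def I_def)
          show "R ((w(x0 := a)) x0) q" using a by (simp add: I_def)
          show "(w(x0 := a)) x0 \<noteq> q" if "d q = 0" using a that by (simp add: I_def)
        next
          fix x assume x: "x \<in> slots d"
          hence "x \<noteq> x0" using x0 by auto
          thus "R ((w(x0 := a)) x) (fst x)" using w x by (auto simp: fillings_def)
          assume "snd x = 0"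
          thus "(w(x0 := a)) x \<noteq> fst x" using w x \<open>x \<noteq> x0\<close> by (auto simp: fillings_def)
        qed
        thus "v \<in> {w\<in>F. w x0 = a}" by (simp add: v)
      qed
      show "(\<lambda>w. w(x0 := undefined)) ` {w\<in>F. w x0 = a} \<subseteq> fillings R d (c(a := c a - 1))"
      proof (intro subsetI, elim imageE)
        fix w v assume w: "w \<in> {w\<in>F. w x0 = a}" and v: "v = w(x0 := undefined)"
        hence wF: "w \<in> F" "w x0 = a" by auto
        show "v \<in> fillings R d (c(a := c a - 1))"
          unfolding fillings_def v mem_Collect_eq count_upd
        proof (intro conjI allI ballI impI)
          show "w(x0 := undefined) \<in> extensional (slots d)"
            using wF by (auto simp: F extensional_def)
          fix b
          have "card {x \<in> slots d. w x = b} + (if w x0 = b then 1 else 0) = c b"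
            using wF(1) unfolding F by blast
          thus "card {x \<in> slots d. w x = b} = (c(a := c a - 1)) b"
            using wF(2) by (cases "a = b") auto
        next
          fix x assume x: "x \<in> slots d"
          hence "x \<noteq> x0" using x0 by auto
          thus "R ((w(x0 := undefined)) x) (fst x)" using wF x by (auto simp: F)
          assume "snd x = 0"
          thus "(w(x0 := undefined)) x \<noteq> fst x" using wF x \<open>x \<noteq> x0\<close> by (auto simp: F)
        qed
      qed
    qed
    thus "card {w\<in>F. w x0 = a} = card (fillings R d (c(a := c a - 1)))"
      by (simp add: bij_betw_same_card)
  qed simp
  finally show ?thesis by (simp add: F_def I_def)
qed

section \<open>Count vectors and the linear system for balanced words\<close>

lemma vectors_pos_bij:
  assumes "finite A" "a \<in> A"
  shows "bij_betw (\<lambda>c. c(a := Suc (c a))) (vectors A n) {c\<in>vectors A (Suc n). c a > 0}"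
proof (rule bij_betw_byWitness[where f' = "\<lambda>c. c(a := c a - 1)"])
  have *: "sum (c(a := x)) A = sum c (A - {a}) + x" for c :: "'a \<Rightarrow> nat" and x
    using assms by (simp add: sum.remove)
  have **: "sum c A = sum c (A - {a}) + c a" for c :: "'a \<Rightarrow> nat"
    using assms by (simp add: sum.remove)
  show "(\<lambda>c. c(a := Suc (c a))) ` vectors A n \<subseteq> {c\<in>vectors A (Suc n). c a > 0}"
    using assms * ** by (auto simp: vectors_def)
  show "(\<lambda>c. c(a := c a - 1)) ` {c\<in>vectors A (Suc n). c a > 0} \<subseteq> vectors A n"
    using assms * ** by (auto simp: vectors_def)
qed (auto simp: fun_eq_iff)

lemma sum_vectors_pos:
  assumes "finite A" "a \<in> A"
  shows "(\<Sum>c\<in>{c\<in>vectors A n. c a > 0}. f c) =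
    (case n of 0 \<Rightarrow> 0 | Suc k \<Rightarrow> \<Sum>c\<in>vectors A k. f (c(a := Suc (c a))))"
proof (cases n)
  case 0
  have "{c\<in>vectors A 0. c a > 0} = {}" using assms by (auto simp: vectors_def)
  thus ?thesis using 0 by (simp del: Collect_empty_eq)
next
  case (Suc k)
  show ?thesis unfolding Suc nat.case
    using vectors_pos_bij[OF assms, of k] by (rule sum.reindex_bij_betw[symmetric])
qed

text \<open>The coefficient at \<open>n\<close> belongs to vectors of sum \<open>n - 1\<close>: the shift makes \<open>near_balanced R A p p n\<close> count
  exactly the balanced fillings of size \<open>n\<close> that use the letter \<open>p\<close>.\<close>

definition near_balanced :: "('a \<Rightarrow> 'a \<Rightarrow> bool) \<Rightarrow> 'a set \<Rightarrow> 'a \<Rightarrow> 'a \<Rightarrow> nat \<Rightarrow> nat" where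
  "near_balanced R A p q n = (case n of 0 \<Rightarrow> 0 | Suc k \<Rightarrow>
     \<Sum>c\<in>vectors A k. card (fillings R (c(q := Suc (c q))) (c(p := Suc (c p)))))"

lemma sum_fillings_pos:
  assumes "finite A" "p \<in> A"
  shows "(\<Sum>c\<in>{c\<in>vectors A n. c p > 0}. card (fillings R c c)) = near_balanced R A p p n"
  by (simp add: sum_vectors_pos[OF assms] near_balanced_def)

text \<open>Vectors with \<open>c p = 0\<close> live on the smaller alphabet \<open>A - {p}\<close>;
  the others are what the shifted series counts. This drives the induction over the
  alphabet.\<close>

lemma balanced_remove:
  assumes "finite A" "p \<in> A"
  shows "balanced R A n = near_balanced R A p p n + balanced R (A - {p}) n"
proof -
  have split: "vectors A n = {c\<in>vectors A n. c p > 0} \<union> vectors (A - {p}) n"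
    using assms by (auto simp: vectors_def sum.remove)
  have "{c\<in>vectors A n. c p > 0} \<inter> vectors (A - {p}) n = {}"
    by (auto simp: vectors_def)
  moreover have "finite {c\<in>vectors A n. c p > 0}" "finite (vectors (A - {p}) n)"
    using assms by (simp_all add: finite_vectors)
  ultimately have "balanced R A n =
      (\<Sum>c\<in>{c\<in>vectors A n. c p > 0}. card (fillings R c c)) + balanced R (A - {p}) n"
    unfolding balanced_def by (subst split) (simp add: sum.union_disjoint)
  thus ?thesis by (simp add: sum_fillings_pos[OF assms])
qed

text \<open>Peel the last slot of block \<open>q\<close>: if it holds the letter \<open>a\<close>, then the deficit moves from \<open>q\<close> to \<open>a\<close>,
  except for \<open>a = p\<close>, where the filling becomes balanced. This is a linear system for the
  generating functions, a substitute for MacMahon's master theorem.\<close>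

lemma near_balanced_Suc:
  assumes A: "finite A" "p \<in> A" "q \<in> A"
  shows "near_balanced R A p q (Suc n) =
    (\<Sum>a\<in>A. if R a q then near_balanced R A p a n else 0) +
    (if q \<noteq> p \<and> R p q then balanced R (A - {p}) n else 0)"
proof -
  \<comment> \<open>\<open>J a c\<close> says that the letter \<open>a\<close> can stand in the
    peeled slot; \<open>f a c\<close> counts the fillings that remain.\<close>
  define J where "J = (\<lambda>a c. (c(p := Suc (c p))) a > 0 \<and> R a q \<and> \<not> (c q = 0 \<and> a = q))"
  define f where "f = (\<lambda>a c. card (fillings R c ((c(p := Suc (c p)))(a := (c(p := Suc (c p))) a - 1))))"
  have finV: "finite (vectors A n)" using finite_vectors A by auto
  have "near_balanced R A p q (Suc n) = (\<Sum>c\<in>vectors A n. \<Sum>a\<in>{a\<in>A. J a c}. f a c)"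
    unfolding near_balanced_def nat.case J_def f_def
    using A by (intro sum.cong refl card_fillings_Suc) (auto simp: vectors_def)
  also have "\<dots> = (\<Sum>c\<in>vectors A n. \<Sum>a\<in>A. if J a c then f a c else 0)"
    using A by (simp add: sum.inter_filter)
  also have "\<dots> = (\<Sum>a\<in>A. \<Sum>c\<in>vectors A n. if J a c then f a c else 0)"
    by (rule sum.swap)
  also have "\<dots> = (\<Sum>a\<in>A. \<Sum>c\<in>{c\<in>vectors A n. J a c}. f a c)"
    using finV by (simp add: sum.inter_filter)
  also have "\<dots> = (\<Sum>a\<in>A. (if R a q then near_balanced R A p a n else 0) +
      (if a = p then if q \<noteq> p \<and> R p q then balanced R (A - {p}) n else 0 else 0))"
  proof (rule sum.cong)
    fix a assume a: "a \<in> A"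
    show "(\<Sum>c\<in>{c\<in>vectors A n. J a c}. f a c) = (if R a q then near_balanced R A p a n else 0) +
      (if a = p then if q \<noteq> p \<and> R p q then balanced R (A - {p}) n else 0 else 0)"
    proof (cases "R a q")
      case False
      hence "{c\<in>vectors A n. J a c} = {}" by (auto simp: J_def)
      thus ?thesis using False by (auto simp del: Collect_empty_eq)
    next
      case R: True
      \<comment> \<open>If \<open>a \<noteq> p\<close>, the letter \<open>a\<close> must be
        available in \<open>c\<close>, and the deficit moves to \<open>a\<close>. If
        \<open>a = p = q\<close>, slot 0 excludes \<open>c p = 0\<close>, so the balanced fillings
        that use \<open>p\<close> remain. If \<open>a = p\<close> and \<open>q \<noteq> p\<close>,
        all balanced fillings remain, which yields the extra term for
        \<open>A - {p}\<close>.\<close>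
      consider "a \<noteq> p" | "a = p" "q = p" | "a = p" "q \<noteq> p" by blast
      thus ?thesis
      proof cases
        case 1
        hence "{c\<in>vectors A n. J a c} = {c\<in>vectors A n. c a > 0}" using R by (auto simp: J_def)
        moreover have "f a (c(a := Suc (c a))) =
            card (fillings R (c(a := Suc (c a))) (c(p := Suc (c p))))" for c
          unfolding f_def using 1 by (intro arg_cong[of _ _ card] arg_cong2[of _ _ _ _ "fillings R"]) auto
        ultimately show ?thesis
          using R 1 A a by (simp add: sum_vectors_pos near_balanced_def split: nat.split)
      next
        case 2
        hence "{c\<in>vectors A n. J a c} = {c\<in>vectors A n. c p > 0}" using R by (auto simp: J_def)
        moreover have "f a c = card (fillings R c c)" for c
          unfolding f_def \<open>a = p\<close> by simp
        ultimately have "(\<Sum>c\<in>{c\<in>vectors A n. J a c}. f a c) = near_balanced R A p p n"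
          by (simp only: sum_fillings_pos[OF A(1,2)])
        thus ?thesis using R 2 by simp
      next
        case 3
        hence "{c\<in>vectors A n. J a c} = vectors A n" using R by (auto simp: J_def)
        moreover have "f a c = card (fillings R c c)" for c
          unfolding f_def \<open>a = p\<close> by simp
        ultimately have "(\<Sum>c\<in>{c\<in>vectors A n. J a c}. f a c) = balanced R A n"
          by (simp only: balanced_def)
        thus ?thesis using R 3 by (simp add: balanced_remove[OF A(1,2)])
      qed
    qed
  qed simp
  also have "\<dots> = (\<Sum>a\<in>A. if R a q then near_balanced R A p a n else 0) +
    (if q \<noteq> p \<and> R p q then balanced R (A - {p}) n else 0)"
    using A by (simp add: sum.distrib)
  finally show ?thesis .
qed

lemma balanced_empty: "balanced R ({} :: 'a set) n = (if n = 0 then 1 else 0)"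
proof -
  have "vectors ({} :: 'a set) n = (if n = 0 then {\<lambda>_. 0} else {})"
    by (auto simp: vectors_def)
  moreover have "fillings R (\<lambda>_. 0) (\<lambda>_. 0) = {\<lambda>_. undefined}"
    by (auto simp: fillings_def slots_def)
  ultimately show ?thesis by (simp add: balanced_def)
qed

text \<open>Induction over the alphabet. The series \<open>g q\<close> solve a linear system whose
  matrix is the identity minus \<open>fps_X\<close> times the matrix of \<open>R\<close>, with
  right-hand sides given by the series \<open>\<sigma>\<close> of the smaller alphabet.\<close>

lemma rational_balanced:
  "finite A \<Longrightarrow> rational_fraction_su (Abs_fps (\<lambda>n. of_nat (balanced R A n)))"
proof (induction A rule: finite_induct)
  case empty
  have "Abs_fps (\<lambda>n. of_nat (balanced R {} n)) = (1 :: int poly fps)"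
    by (rule fps_ext) (simp add: balanced_empty)
  thus ?case by simp
next
  case (insert p B)
  define A where "A = insert p B"
  have A: "finite A" "p \<in> A" "A - {p} = B" using insert.hyps by (auto simp: A_def)
  define \<sigma> :: "int poly fps" where "\<sigma> = Abs_fps (\<lambda>n. of_nat (balanced R B n))"
  define g :: "'a \<Rightarrow> int poly fps" where "g = (\<lambda>q. Abs_fps (\<lambda>n. of_nat (near_balanced R A p q n)))"
  define r where "r = (\<lambda>q. fps_X * (if q \<noteq> p \<and> R p q then \<sigma> else 0))"
  define K :: "'a \<Rightarrow> 'a \<Rightarrow> int poly fps" where
    "K = (\<lambda>q a. (if q = a then 1 else 0) - (if R a q then fps_X else 0))"
  have g: "g q = fps_X * (\<Sum>a\<in>A. if R a q then g a else 0) + r q" if "q \<in> A" for q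
  proof (rule fps_ext)
    fix n
    show "fps_nth (g q) n = fps_nth (fps_X * (\<Sum>a\<in>A. if R a q then g a else 0) + r q) n"
    proof (cases n)
      case 0
      thus ?thesis by (simp add: g_def r_def near_balanced_def)
    next
      case (Suc k)
      have "fps_nth (\<Sum>a\<in>A. if R a q then g a else 0) k =
          (\<Sum>a\<in>A. of_nat (if R a q then near_balanced R A p a k else 0))"
        unfolding fps_sum_nth by (rule sum.cong) (auto simp: g_def)
      thus ?thesis using Suc near_balanced_Suc[OF A(1,2) that, of R k] A(3)
        by (simp add: g_def r_def \<sigma>_def)
    qed
  qed
  have "\<forall>q\<in>A. rational_fraction_su (g q)"
  proof (rule rational_linear_system[of A K r])
    fix q assume q: "q \<in> A"
    show "rational_fraction_su (r q)"
      using insert.IH by (auto simp: r_def \<sigma>_def intro!: rational_mult)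
    have "(\<Sum>a\<in>A. K q a * g a) = (\<Sum>a\<in>A. (if q = a then g a else 0) - fps_X * (if R a q then g a else 0))"
      by (rule sum.cong) (auto simp: K_def algebra_simps)
    also have "\<dots> = g q - fps_X * (\<Sum>a\<in>A. if R a q then g a else 0)"
      using A q by (simp add: sum_subtractf sum_distrib_left)
    finally show "(\<Sum>a\<in>A. K q a * g a) = r q" using g[OF q] by simp
    show "rational_fraction_su (K q a)" for a
      unfolding K_def by (rule rational_diff) auto
  qed (use A in \<open>auto simp: K_def\<close>)
  \<comment> \<open>\<open>g p\<close> collects the balanced fillings that use \<open>p\<close>, and
    \<open>\<sigma>\<close> those that do not.\<close>
  hence "rational_fraction_su (g p + \<sigma>)"
    using A insert.IH by (intro rational_add) (auto simp: \<sigma>_def)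
  also have "g p + \<sigma> = Abs_fps (\<lambda>n. of_nat (balanced R A n))"
    using A by (intro fps_ext) (simp add: g_def \<sigma>_def balanced_remove[OF A(1,2)])
  finally show ?case by (simp add: A_def)
qed

section \<open>Restriction to count vectors without zero entries\<close>

definition full_balanced :: "('a \<Rightarrow> 'a \<Rightarrow> bool) \<Rightarrow> 'a set \<Rightarrow> nat \<Rightarrow> nat" where
  "full_balanced R A n = (\<Sum>c\<in>{c\<in>vectors A n. \<forall>a\<in>A. c a > 0}. card (fillings R c c))"

text \<open>Vectors are grouped by their support \<open>B\<close>; the fillings depend on the vector
  alone, not on the ambient alphabet.\<close>

lemma balanced_eq_sum_full:
  assumes A: "finite A"
  shows "balanced R A n = (\<Sum>B\<in>Pow A. full_balanced R B n)"
proof -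
  have eq: "{c\<in>vectors A n. {a\<in>A. c a > 0} = B} = {c\<in>vectors B n. \<forall>a\<in>B. c a > 0}"
    if "B \<in> Pow A" for B
  proof -
    have B: "B \<subseteq> A" using that by auto
    have sum_eq: "sum c A = sum c B" if "\<forall>a\<in>A - B. c a = 0" for c :: "'a \<Rightarrow> nat"
      using A B that by (intro sum.mono_neutral_right) auto
    show ?thesis
    proof (intro set_eqI iffI)
      fix c assume c: "c \<in> {c\<in>vectors A n. {a\<in>A. c a > 0} = B}"
      hence zero: "c a = 0" if "a \<notin> B" for a
        using that by (cases "a \<in> A") (auto simp: vectors_def)
      hence "sum c A = sum c B" by (intro sum_eq) auto
      thus "c \<in> {c\<in>vectors B n. \<forall>a\<in>B. c a > 0}" using c zero by (auto simp: vectors_def)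
    next
      fix c assume c: "c \<in> {c\<in>vectors B n. \<forall>a\<in>B. c a > 0}"
      hence zero: "c a = 0" if "a \<notin> B" for a
        using that by (auto simp: vectors_def)
      hence "sum c A = sum c B" by (intro sum_eq) auto
      moreover have "{a\<in>A. c a > 0} = B" using c zero B by force
      ultimately show "c \<in> {c\<in>vectors A n. {a\<in>A. c a > 0} = B}"
        using c zero B by (auto simp: vectors_def)
    qed
  qed
  have "balanced R A n = (\<Sum>B\<in>Pow A. \<Sum>c\<in>{c\<in>vectors A n. {a\<in>A. c a > 0} = B}. card (fillings R c c))"
    unfolding balanced_def using A finite_vectors by (intro sum.group[symmetric]) auto
  also have "\<dots> = (\<Sum>B\<in>Pow A. full_balanced R B n)"
    unfolding full_balanced_def by (intro sum.cong refl) (simp only: eq)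
  finally show ?thesis .
qed

text \<open>Inversion over subsets: the terms of the proper subsets are rational by induction and
  are subtracted from the series of \<open>balanced R A\<close>.\<close>

lemma rational_full_balanced:
  "finite A \<Longrightarrow> rational_fraction_su (Abs_fps (\<lambda>n. of_nat (full_balanced R A n)))"
proof (induction A rule: finite_psubset_induct)
  case (psubset A)
  have "rational_fraction_su (Abs_fps (\<lambda>n. of_nat (balanced R A n)) -
      (\<Sum>B\<in>Pow A - {A}. Abs_fps (\<lambda>n. of_nat (full_balanced R B n))))"
    using psubset by (intro rational_diff rational_sum rational_balanced) auto
  also have "Abs_fps (\<lambda>n. of_nat (balanced R A n)) -
      (\<Sum>B\<in>Pow A - {A}. Abs_fps (\<lambda>n. of_nat (full_balanced R B n))) =
      (Abs_fps (\<lambda>n. of_nat (full_balanced R A n)) :: int poly fps)"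
  proof (rule fps_ext)
    fix n
    have "balanced R A n = full_balanced R A n + (\<Sum>B\<in>Pow A - {A}. full_balanced R B n)"
      unfolding balanced_eq_sum_full[OF psubset.hyps] using psubset.hyps
      by (intro sum.remove) auto
    thus "fps_nth (Abs_fps (\<lambda>n. of_nat (balanced R A n)) -
      (\<Sum>B\<in>Pow A - {A}. Abs_fps (\<lambda>n. of_nat (full_balanced R B n)))) n =
      fps_nth (Abs_fps (\<lambda>n. of_nat (full_balanced R A n)) :: int poly fps) n"
      by (simp add: fps_sum_nth)
  qed
  finally show ?case .
qed

section \<open>Permutations with prescribed segments\<close>

text \<open>The number of positions before segment \<open>a\<close>. Segments are numbered from 0
  and positions from 1, so segment \<open>a\<close> runs from \<open>off c a + 1\<close> to
  \<open>off c (Suc a)\<close>.\<close>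

definition off :: "(nat \<Rightarrow> nat) \<Rightarrow> nat \<Rightarrow> nat" where
  "off c a = sum c {..<a}"

definition seg :: "(nat \<Rightarrow> nat) \<Rightarrow> nat \<Rightarrow> nat" where
  "seg c i = (LEAST a. i \<le> off c (Suc a))"

lemma off_0 [simp]: "off c 0 = 0"
  by (simp add: off_def)

lemma off_Suc: "off c (Suc a) = off c a + c a"
  by (simp add: off_def)

lemma off_mono: "a \<le> b \<Longrightarrow> off c a \<le> off c b"
  unfolding off_def by (rule sum_mono2) auto

lemma off_length: "c \<in> vectors {..<L} n \<Longrightarrow> off c L = n"
  by (simp add: off_def vectors_def)

lemma off_le:
  assumes "c \<in> vectors {..<L} n"
  shows "off c a \<le> n"
proof (cases "a \<le> L")
  case True
  thus ?thesis using off_mono[OF True, of c] off_length[OF assms] by simp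
next
  case False
  hence "off c a = off c L"
    unfolding off_def using assms by (intro sum.mono_neutral_right) (auto simp: vectors_def)
  thus ?thesis using off_length[OF assms] by simp
qed

lemma seg_eqI:
  assumes "off c a < i" "i \<le> off c (Suc a)"
  shows "seg c i = a"
  unfolding seg_def
proof (rule Least_equality)
  fix b assume "i \<le> off c (Suc b)"
  thus "a \<le> b" using assms off_mono[of "Suc b" a c] by (cases "a \<le> b") auto
qed (use assms in auto)

lemma seg_bounds:
  assumes "c \<in> vectors {..<L} n" "i \<in> {1..n}"
  shows "off c (seg c i) < i" "i \<le> off c (Suc (seg c i))" "seg c i < L"
proof -
  have "L \<noteq> 0" using assms by (intro notI) (auto simp: vectors_def)
  then obtain L' where L: "L = Suc L'" by (cases L) auto
  have L': "i \<le> off c (Suc L')" using assms off_length[OF assms(1)] L by simp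
  show "i \<le> off c (Suc (seg c i))" unfolding seg_def by (rule LeastI[of "\<lambda>a. i \<le> off c (Suc a)", OF L'])
  have "seg c i \<le> L'" unfolding seg_def by (rule Least_le[of "\<lambda>a. i \<le> off c (Suc a)", OF L'])
  thus "seg c i < L" using L by simp
  show "off c (seg c i) < i"
  proof (cases "seg c i")
    case 0
    thus ?thesis using assms by simp
  next
    case (Suc b)
    hence "b < seg c i" by simp
    hence "\<not> i \<le> off c (Suc b)" unfolding seg_def by (rule not_less_Least)
    thus ?thesis using Suc by simp
  qed
qed

lemma seg_mono:
  assumes "c \<in> vectors {..<L} n" "i \<in> {1..n}" "j \<in> {1..n}" "i \<le> j"
  shows "seg c i \<le> seg c j"
proof (rule ccontr)
  assume "\<not> ?thesis"
  hence "off c (Suc (seg c j)) \<le> off c (seg c i)" by (intro off_mono) auto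
  thus False using seg_bounds(1)[OF assms(1,2)] seg_bounds(2)[OF assms(1,3)] assms(4) by simp
qed

lemma seg_fibre:
  assumes "c \<in> vectors {..<L} n"
  shows "{i\<in>{1..n}. seg c i = a} = {off c a<..off c (Suc a)}"
proof (intro set_eqI iffI)
  fix i assume "i \<in> {off c a<..off c (Suc a)}"
  thus "i \<in> {i\<in>{1..n}. seg c i = a}"
    using seg_eqI[of c a i] off_le[OF assms, of "Suc a"] by simp
qed (use seg_bounds(1,2)[OF assms] in auto)

lemma in_segI:
  assumes "c \<in> vectors {..<L} n" "off c a < i" "i \<le> off c (Suc a)"
  shows "i \<in> {1..n}" "seg c i = a"
proof -
  have "i \<in> {i\<in>{1..n}. seg c i = a}"
    unfolding seg_fibre[OF assms(1)] using assms(2,3) by simp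
  thus "i \<in> {1..n}" "seg c i = a" by simp_all
qed

lemma card_seg_fibre:
  assumes "c \<in> vectors {..<L} n"
  shows "card {i\<in>{1..n}. seg c i = a} = c a"
  unfolding seg_fibre[OF assms] by (simp add: off_Suc)

text \<open>Values in segment \<open>b\<close> are enumerated upwards if \<open>b\<close> is an excedance segment (\<open>b \<in> E\<close>) and downwards otherwise,
  so that slot \<open>0\<close> is the only value that could create a fixed point.\<close>

definition val :: "nat set \<Rightarrow> (nat \<Rightarrow> nat) \<Rightarrow> nat \<times> nat \<Rightarrow> nat" where
  "val E c x = (if fst x \<in> E then off c (fst x) + 1 + snd x else off c (Suc (fst x)) - snd x)"

lemma seg_val:
  assumes "x \<in> slots c"
  shows "seg c (val E c x) = fst x"
  by (rule seg_eqI) (use assms in \<open>auto simp: slots_def val_def off_Suc\<close>)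

lemma val_bij:
  assumes "c \<in> vectors {..<L} n"
  shows "bij_betw (val E c) (slots c) {1..n}"
proof (rule bij_betw_byWitness)
  \<comment> \<open>The inverse of \<open>val\<close>: the slot of \<open>i\<close> is its distance
    from the first element of a segment in \<open>E\<close>, and from the last element
    otherwise.\<close>
  let ?f = "\<lambda>i. (seg c i, if seg c i \<in> E then i - 1 - off c (seg c i) else off c (Suc (seg c i)) - i)"
  show "\<forall>x\<in>slots c. ?f (val E c x) = x"
  proof
    fix x assume x: "x \<in> slots c"
    show "?f (val E c x) = x"
      unfolding seg_val[OF x] using x by (cases x) (auto simp: val_def slots_def off_Suc)
  qed
  show "\<forall>i\<in>{1..n}. val E c (?f i) = i"
    using seg_bounds[OF assms] by (fastforce simp: val_def)
  show "?f ` {1..n} \<subseteq> slots c"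
  proof
    fix x assume "x \<in> ?f ` {1..n}"
    then obtain i where i: "i \<in> {1..n}" "x = ?f i" by auto
    show "x \<in> slots c"
      using seg_bounds(1,2)[OF assms i(1)] unfolding i(2) slots_def by (auto simp: off_Suc)
  qed
  show "val E c ` slots c \<subseteq> {1..n}"
  proof
    fix i assume "i \<in> val E c ` slots c"
    then obtain x where x: "x \<in> slots c" "i = val E c x" by auto
    have "off c (Suc (fst x)) \<le> n" using off_le[OF assms] .
    thus "i \<in> {1..n}" using x by (auto simp: val_def slots_def off_Suc)
  qed
qed

text \<open>The rank of \<open>f i\<close> in the image is the rank of \<open>i\<close> in
  \<open>I\<close>, and likewise for \<open>g\<close>; elements of equal rank coincide. It serves to
  recover a permutation from its word and a composition from its cuts.\<close>

lemma strict_mono_on_image_eq: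
  fixes f g :: "'a::linorder \<Rightarrow> 'b::linorder"
  assumes "finite I" "strict_mono_on I f" "strict_mono_on I g" "f ` I = g ` I" "i \<in> I"
  shows "f i = g i"
proof -
  have *: "card {y \<in> h ` I. y < h i} = card {j\<in>I. j < i}" if "strict_mono_on I h" for h :: "'a \<Rightarrow> 'b"
  proof -
    have "{y \<in> h ` I. y < h i} = h ` {j\<in>I. j < i}"
      using strict_mono_on_less[OF that] assms(5) by auto
    thus ?thesis
      using strict_mono_on_imp_inj_on[OF that] by (simp add: card_image inj_on_subset)
  qed
  have **: "\<not> y < z" if "y \<in> f ` I" "card {x \<in> f ` I. x < y} = card {x \<in> f ` I. x < z}" for y z
  proof
    assume "y < z"
    hence "{x \<in> f ` I. x < y} \<subset> {x \<in> f ` I. x < z}" using that(1) by auto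
    hence "card {x \<in> f ` I. x < y} < card {x \<in> f ` I. x < z}"
      using assms(1) by (intro psubset_card_mono) auto
    thus False using that(2) by simp
  qed
  have "card {x \<in> f ` I. x < f i} = card {x \<in> f ` I. x < g i}"
    using *[OF assms(2)] *[OF assms(3)] assms(4) by simp
  thus ?thesis
    using **[of "f i" "g i"] **[of "g i" "f i"] assms(4,5) by (metis imageI neqE)
qed

section \<open>The bijection between permutations with given segments and signs and balanced
  words\<close>

definition allowed :: "nat set \<Rightarrow> nat \<Rightarrow> nat \<Rightarrow> bool" where
  "allowed E a b \<longleftrightarrow> a = b \<or> (a \<in> E \<and> a < b) \<or> (a \<notin> E \<and> b < a)"

definition shaped :: "nat set \<Rightarrow> (nat \<Rightarrow> nat) \<Rightarrow> nat \<Rightarrow> (nat \<Rightarrow> nat) set" where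
  "shaped E c n = {p. p permutes {1..n} \<and>
     (\<forall>i\<in>{1..n}. \<forall>j\<in>{1..n}. i < j \<and> seg c i = seg c j \<longrightarrow> p i < p j) \<and>
     (\<forall>i\<in>{1..n}. if seg c i \<in> E then i < p i else p i < i)}"

definition word_of :: "nat set \<Rightarrow> (nat \<Rightarrow> nat) \<Rightarrow> (nat \<Rightarrow> nat) \<Rightarrow> nat \<times> nat \<Rightarrow> nat" where
  "word_of E c p = restrict (\<lambda>x. seg c (inv p (val E c x))) (slots c)"

text \<open>A position below its value lies in no later segment than the value, and dually; this
  gives \<open>allowed\<close>. Letter and block may agree, as segments then do not reveal the sign,
  and slot 0 provides the strictness. The letter \<open>a\<close> occurs once for each position in
  segment \<open>a\<close>.\<close>

lemma word_of_in_fillings: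
  assumes c: "c \<in> vectors {..<L} n" and p: "p \<in> shaped E c n"
  shows "word_of E c p \<in> fillings (allowed E) c c"
  unfolding fillings_def mem_Collect_eq
proof (intro conjI allI ballI impI)
  show "word_of E c p \<in> extensional (slots c)" by (simp add: word_of_def)
  have perm: "p permutes {1..n}" using p by (simp add: shaped_def)
  have bij: "bij_betw (\<lambda>x. inv p (val E c x)) (slots c) {1..n}"
    using bij_betw_trans[OF val_bij[OF c] permutes_imp_bij[OF permutes_inv[OF perm]]]
    by (simp add: o_def)
  fix a
  have "{x \<in> slots c. word_of E c p x = a} = {x \<in> slots c. seg c (inv p (val E c x)) = a}"
    by (auto simp: word_of_def)
  also have "card \<dots> = card {i\<in>{1..n}. seg c i = a}"
  proof (rule bij_betw_same_card)
    show "bij_betw (\<lambda>x. inv p (val E c x)) {x \<in> slots c. seg c (inv p (val E c x)) = a}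
        {i\<in>{1..n}. seg c i = a}"
      using bij by (auto simp: bij_betw_def inj_on_def)
  qed
  finally show "card {x \<in> slots c. word_of E c p x = a} = c a"
    by (simp only: card_seg_fibre[OF c])
next
  have perm: "p permutes {1..n}" using p by (simp add: shaped_def)
  fix x assume x: "x \<in> slots c"
  define v where "v = val E c x"
  define i where "i = inv p v"
  have v: "v \<in> {1..n}" unfolding v_def by (rule bij_betw_apply[OF val_bij[OF c] x])
  have i: "i \<in> {1..n}" using v permutes_in_image[OF permutes_inv[OF perm]] by (simp add: i_def)
  have pi: "p i = v" unfolding i_def using perm by (simp add: permutes_inverses)
  have w: "word_of E c p x = seg c i" using x by (simp add: word_of_def i_def v_def)
  have b: "fst x = seg c v" using x by (simp add: v_def seg_val)
  have sign: "if seg c i \<in> E then i < v else v < i"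
    using p i pi by (auto simp: shaped_def)
  show "allowed E (word_of E c p x) (fst x)"
    unfolding w b allowed_def using sign seg_mono[OF c i v] seg_mono[OF c v i]
    by (auto split: if_splits)
  assume "snd x = 0"
  \<comment> \<open>Slot 0 of a segment in \<open>E\<close> is its least value, so no smaller
    position lies in that segment; outside \<open>E\<close> it is the greatest value, and no larger
    position does.\<close>
  show "word_of E c p x \<noteq> fst x"
  proof
    assume "word_of E c p x = fst x"
    hence s: "seg c i = fst x" "seg c v = fst x" using w b by auto
    show False
      using sign seg_bounds(1,2)[OF c i] \<open>snd x = 0\<close> unfolding s v_def val_def
      by (auto split: if_splits)
  qed
qed

text \<open>The word fixes the set of values taken on each segment, and the permutation increases
  there.\<close>

lemma word_of_inj:
  assumes c: "c \<in> vectors {..<L} n"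
  shows "inj_on (word_of E c) (shaped E c n)"
proof (rule inj_onI)
  fix p q assume p: "p \<in> shaped E c n" and q: "q \<in> shaped E c n"
    and eq: "word_of E c p = word_of E c q"
  have perm: "p permutes {1..n}" "q permutes {1..n}" using p q by (auto simp: shaped_def)
  have seg_eq: "seg c (inv p v) = seg c (inv q v)" if "v \<in> {1..n}" for v
  proof -
    have "v \<in> val E c ` slots c" using val_bij[OF c, of E] that by (simp add: bij_betw_def)
    then obtain x where x: "x \<in> slots c" "v = val E c x" by auto
    have "word_of E c p x = word_of E c q x" by (simp add: eq)
    thus ?thesis using x by (simp add: word_of_def)
  qed
  have image: "r ` {i\<in>{1..n}. seg c i = a} = {v\<in>{1..n}. seg c (inv r v) = a}"
    if r: "r permutes {1..n}" for r a
  proof (intro set_eqI iffI)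
    fix v assume "v \<in> r ` {i\<in>{1..n}. seg c i = a}"
    then obtain i where i: "i \<in> {1..n}" "seg c i = a" "v = r i" by auto
    show "v \<in> {v\<in>{1..n}. seg c (inv r v) = a}"
      unfolding i(3) using i(1,2) permutes_in_image[OF r, of i] permutes_inverses(2)[OF r] by auto
  next
    fix v assume v: "v \<in> {v\<in>{1..n}. seg c (inv r v) = a}"
    have "v = r (inv r v)" "inv r v \<in> {1..n}"
      using v permutes_in_image[OF permutes_inv[OF r], of v] permutes_inverses(1)[OF r] by auto
    thus "v \<in> r ` {i\<in>{1..n}. seg c i = a}" using v by blast
  qed
  show "p = q"
  proof
    fix i
    show "p i = q i"
    proof (cases "i \<in> {1..n}")
      case False
      thus ?thesis using perm by (simp add: permutes_def)
    next
      case True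
      define I where "I = {j\<in>{1..n}. seg c j = seg c i}"
      show ?thesis
      proof (rule strict_mono_on_image_eq[of I p q i])
        show "strict_mono_on I p" "strict_mono_on I q"
          using p q by (auto simp: I_def shaped_def strict_mono_on_def)
        show "p ` I = q ` I"
          unfolding I_def image[OF perm(1)] image[OF perm(2)] using seg_eq by auto
      qed (use True in \<open>auto simp: I_def\<close>)
    qed
  qed
qed

text \<open>The values with letter \<open>a\<close> are placed in increasing order on segment
  \<open>a\<close>; balance makes them fit exactly.\<close>

lemma word_of_surj:
  assumes c: "c \<in> vectors {..<L} n" and w: "w \<in> fillings (allowed E) c c"
  shows "\<exists>p\<in>shaped E c n. word_of E c p = w"
proof -
  \<comment> \<open>\<open>u v\<close> is the letter at the value \<open>v\<close>, that is, the
    segment in which \<open>v\<close> is to be placed.\<close>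
  define u where "u = (\<lambda>v. w (inv_into (slots c) (val E c) v))"
  have inj: "inj_on (val E c) (slots c)" and im: "val E c ` slots c = {1..n}"
    using val_bij[OF c, of E] by (auto simp: bij_betw_def)
  have u_val: "u (val E c x) = w x" if "x \<in> slots c" for x
    using that inj by (simp add: u_def)
  have card_V: "card {v\<in>{1..n}. u v = a} = c a" for a
  proof -
    have "{v\<in>{1..n}. u v = a} = val E c ` {x\<in>slots c. w x = a}"
      unfolding im[symmetric] using u_val by auto
    also have "card \<dots> = card {x\<in>slots c. w x = a}"
      using inj by (intro card_image) (auto simp: inj_on_def)
    also have "\<dots> = c a" using w by (simp add: fillings_def)
    finally show ?thesis .
  qed
  have "\<exists>h. bij_betw h {..<c a} {v\<in>{1..n}. u v = a} \<and> strict_mono_on {..<c a} h" for a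
    using ex_bij_betw_strict_mono_card[of "{v\<in>{1..n}. u v = a}"] card_V[of a] by auto
  then obtain h where h: "\<And>a. bij_betw (h a) {..<c a} {v\<in>{1..n}. u v = a}"
    "\<And>a. strict_mono_on {..<c a} (h a)" by metis
  \<comment> \<open>\<open>i - off c (seg c i) - 1\<close> is the rank of \<open>i\<close> in its
    segment, counted from 0.\<close>
  define p where "p = (\<lambda>i. if i \<in> {1..n} then h (seg c i) (i - off c (seg c i) - 1) else i)"
  have idx: "i - off c (seg c i) - 1 < c (seg c i)" if "i \<in> {1..n}" for i
    using seg_bounds(1,2)[OF c that] by (auto simp: off_Suc)
  have p_in: "p i \<in> {1..n}" and u_p: "u (p i) = seg c i" if i: "i \<in> {1..n}" for i
  proof -
    have "p i \<in> {v\<in>{1..n}. u v = seg c i}"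
      using h(1)[of "seg c i"] idx[OF i] i unfolding p_def by (auto simp: bij_betw_def)
    thus "p i \<in> {1..n}" "u (p i) = seg c i" by auto
  qed
  have mono: "p i < p j" if "i \<in> {1..n}" "j \<in> {1..n}" "i < j" "seg c i = seg c j" for i j
  proof -
    have "i - off c (seg c i) - 1 < j - off c (seg c i) - 1"
      using seg_bounds(1)[OF c that(1)] that(3) by linarith
    thus ?thesis
      using strict_mono_onD[OF h(2)[of "seg c i"]] idx[OF that(1)] idx[OF that(2)] that
      by (simp add: p_def)
  qed
  have "inj_on p {1..n}"
  proof (rule linorder_inj_onI')
    fix i j assume ij: "i \<in> {1..n}" "j \<in> {1..n}" "i < j"
    show "p i \<noteq> p j"
    proof
      assume "p i = p j"
      hence "seg c i = seg c j" using u_p ij(1,2) by metis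
      thus False using mono[OF ij] \<open>p i = p j\<close> by simp
    qed
  qed
  moreover have "p ` {1..n} = {1..n}"
    using p_in \<open>inj_on p {1..n}\<close> by (intro endo_inj_surj) auto
  ultimately have perm: "p permutes {1..n}"
    by (intro bij_imp_permutes) (auto simp: bij_betw_def p_def)
  have w_p: "allowed E (seg c i) (seg c (p i))"
    "p i = val E c (a, 0) \<Longrightarrow> c a > 0 \<Longrightarrow> seg c i \<noteq> a" if i: "i \<in> {1..n}" for i a
  proof -
    obtain x where x: "x \<in> slots c" "p i = val E c x"
      using p_in[OF i] im by (metis imageE)
    have wx: "w x = seg c i" "seg c (p i) = fst x"
      using u_val[OF x(1)] u_p[OF i] seg_val[OF x(1)] x(2) by auto
    show "allowed E (seg c i) (seg c (p i))"
      using w x(1) unfolding wx(2) by (auto simp: fillings_def wx(1)[symmetric])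
    assume "p i = val E c (a, 0)" "c a > 0"
    hence "x = (a, 0)" using inj x by (auto simp: inj_on_def slots_def)
    thus "seg c i \<noteq> a" using w x(1) wx by (auto simp: fillings_def)
  qed
  \<comment> \<open>The first position of a segment in \<open>E\<close> has its value in no earlier
    segment, and slot 0 forbids a fixed point there. Since \<open>p\<close> increases, strict
    excedance passes on to the following positions.\<close>
  have pos: "i < p i" if "i \<in> {1..n}" "seg c i \<in> E" for i
  proof -
    define a where "a = seg c i"
    have "k < c a \<Longrightarrow> off c a + 1 + k < p (off c a + 1 + k)" for k
    proof (induction k)
      case 0
      let ?i = "off c a + 1 + 0"
      have i: "?i \<in> {1..n}" "seg c ?i = a"
        using in_segI[OF c, of a ?i] 0 by (simp_all add: off_Suc)
      have "a \<le> seg c (p ?i)" using w_p(1)[OF i(1)] that i(2) by (auto simp: allowed_def a_def)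
      hence "off c a \<le> off c (seg c (p ?i))" by (rule off_mono)
      hence "?i \<le> p ?i" using seg_bounds(1)[OF c p_in[OF i(1)]] by simp
      moreover have "p ?i \<noteq> ?i"
        using w_p(2)[OF i(1), of a] 0 i(2) that by (auto simp: val_def a_def)
      ultimately show ?case by simp
    next
      case (Suc k)
      have i: "off c a + 1 + k \<in> {1..n}" "seg c (off c a + 1 + k) = a"
        "off c a + 1 + Suc k \<in> {1..n}" "seg c (off c a + 1 + Suc k) = a"
        using in_segI[OF c, of a "off c a + 1 + k"] in_segI[OF c, of a "off c a + 1 + Suc k"] Suc.prems
        by (simp_all add: off_Suc)
      have "p (off c a + 1 + k) < p (off c a + 1 + Suc k)"
        by (rule mono) (use i in auto)
      thus ?case using Suc by simp
    qed
    from this[of "i - off c a - 1"] show ?thesis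
      using idx[OF that(1)] seg_bounds(1)[OF c that(1)] by (simp add: a_def)
  qed
  \<comment> \<open>The mirror image: the induction starts at the last position of the segment and
    runs downwards.\<close>
  have neg: "p i < i" if "i \<in> {1..n}" "seg c i \<notin> E" for i
  proof -
    define a where "a = seg c i"
    have "k < c a \<Longrightarrow> p (off c (Suc a) - k) < off c (Suc a) - k" for k
    proof (induction k)
      case 0
      let ?i = "off c (Suc a) - 0"
      have i: "?i \<in> {1..n}" "seg c ?i = a"
        using in_segI[OF c, of a ?i] 0 by (simp_all add: off_Suc)
      have "seg c (p ?i) \<le> a" using w_p(1)[OF i(1)] that i(2) by (auto simp: allowed_def a_def)
      hence "off c (Suc (seg c (p ?i))) \<le> off c (Suc a)" by (intro off_mono) auto
      hence "p ?i \<le> ?i" using seg_bounds(2)[OF c p_in[OF i(1)]] by simp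
      moreover have "p ?i \<noteq> ?i"
        using w_p(2)[OF i(1), of a] 0 i(2) that by (auto simp: val_def a_def)
      ultimately show ?case by simp
    next
      case (Suc k)
      have i: "off c (Suc a) - k \<in> {1..n}" "seg c (off c (Suc a) - k) = a"
        "off c (Suc a) - Suc k \<in> {1..n}" "seg c (off c (Suc a) - Suc k) = a"
        using in_segI[OF c, of a "off c (Suc a) - k"] in_segI[OF c, of a "off c (Suc a) - Suc k"] Suc.prems
        by (simp_all add: off_Suc)
      have "p (off c (Suc a) - Suc k) < p (off c (Suc a) - k)"
        by (rule mono) (use i in auto)
      thus ?case using Suc by simp
    qed
    from this[of "off c (Suc a) - i"] show ?thesis
      using seg_bounds(1,2)[OF c that(1)] by (simp add: a_def off_Suc)
  qed
  have "p \<in> shaped E c n"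
    unfolding shaped_def using perm mono pos neg by auto
  moreover have "word_of E c p = w"
  proof (rule extensionalityI[of _ "slots c"])
    fix x assume x: "x \<in> slots c"
    define i where "i = inv p (val E c x)"
    have "val E c x \<in> {1..n}" using im x by auto
    hence i: "i \<in> {1..n}" "p i = val E c x"
      using permutes_in_image[OF permutes_inv[OF perm]] permutes_inverses(1)[OF perm]
      by (auto simp: i_def)
    show "word_of E c p x = w x"
      using x u_p[OF i(1)] u_val[OF x] i(2) by (simp add: word_of_def i_def)
  qed (use w in \<open>auto simp: word_of_def fillings_def\<close>)
  ultimately show ?thesis by blast
qed

lemma card_shaped:
  assumes "c \<in> vectors {..<L} n"
  shows "card (shaped E c n) = card (fillings (allowed E) c c)"
proof (rule bij_betw_same_card)
  show "bij_betw (word_of E c) (shaped E c n) (fillings (allowed E) c c)"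
    unfolding bij_betw_def
  proof (intro conjI equalityI subsetI)
    fix w assume "w \<in> fillings (allowed E) c c"
    from word_of_surj[OF assms this] show "w \<in> word_of E c ` shaped E c n" by blast
  qed (use word_of_inj[OF assms] word_of_in_fillings[OF assms] in auto)
qed

section \<open>Compositions and breaks\<close>

definition comps :: "nat \<Rightarrow> nat \<Rightarrow> (nat \<Rightarrow> nat) set" where
  "comps L n = {c \<in> vectors {..<L} n. \<forall>a\<in>{..<L}. c a > 0}"

text \<open>A cut \<open>i\<close> lies between the positions \<open>i\<close> and
  \<open>Suc i\<close>; the outer ends \<open>off c 0\<close> and \<open>off c L\<close> are left
  out.\<close>

definition cuts :: "nat \<Rightarrow> (nat \<Rightarrow> nat) \<Rightarrow> nat set" where
  "cuts L c = off c ` {1..<L}"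

lemma off_strict_mono:
  assumes "c \<in> comps L n" "a < b" "b \<le> L"
  shows "off c a < off c b"
proof -
  have "off c a < off c (Suc a)" using assms by (simp add: off_Suc comps_def)
  also have "\<dots> \<le> off c b" using assms by (intro off_mono) auto
  finally show ?thesis .
qed

lemma cuts_in:
  assumes c: "c \<in> comps L n"
  shows "cuts L c \<subseteq> {1..<n}" "card (cuts L c) = L - 1"
proof -
  have n: "off c L = n" using c off_length by (auto simp: comps_def)
  show "cuts L c \<subseteq> {1..<n}"
  proof
    fix i assume "i \<in> cuts L c"
    then obtain b where b: "i = off c b" "1 \<le> b" "b < L" by (auto simp: cuts_def)
    thus "i \<in> {1..<n}"
      using off_strict_mono[OF c, of 0 b] off_strict_mono[OF c, of b L] n by simp
  qed
  have "inj_on (off c) {1..<L}"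
    by (rule linorder_inj_onI') (use off_strict_mono[OF c] in \<open>simp add: less_imp_neq\<close>)
  thus "card (cuts L c) = L - 1" by (simp add: cuts_def card_image)
qed

text \<open>The offsets of a composition increase strictly, so their set determines them; the parts
  are their differences.\<close>

lemma cuts_inj: "inj_on (cuts L) (comps L n)"
proof (rule inj_onI)
  fix c d assume c: "c \<in> comps L n" and d: "d \<in> comps L n" and eq: "cuts L c = cuts L d"
  have mid: "off c b = off d b" if "b \<in> {1..<L}" for b
  proof (rule strict_mono_on_image_eq[of "{1..<L}" "off c" "off d" b])
    show "strict_mono_on {1..<L} (off c)" "strict_mono_on {1..<L} (off d)"
      using off_strict_mono[OF c] off_strict_mono[OF d] by (auto simp: strict_mono_on_def)
    show "off c ` {1..<L} = off d ` {1..<L}" using eq by (simp add: cuts_def)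
  qed (use that in auto)
  have top: "off c L = off d L"
    using off_length c d by (auto simp: comps_def)
  have off: "off c b = off d b" if "b \<le> L" for b
  proof -
    have "b = 0 \<or> b \<in> {1..<L} \<or> b = L" using that by auto
    thus ?thesis using mid[of b] top by auto
  qed
  show "c = d"
  proof
    fix a
    show "c a = d a"
    proof (cases "a < L")
      case True
      thus ?thesis using off[of a] off[of "Suc a"] by (simp add: off_Suc)
    next
      case False
      thus ?thesis using c d by (simp add: comps_def vectors_def)
    qed
  qed
qed

lemma cuts_surj:
  assumes "L > 0" "n > 0" and T: "T \<subseteq> {1..<n}" "card T = L - 1"
  shows "\<exists>c\<in>comps L n. cuts L c = T"
proof -
  have finT: "finite T" using T(1) finite_subset by blast
  obtain h where h: "bij_betw h {..<L - 1} T" "strict_mono_on {..<L - 1} h"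
    using ex_bij_betw_strict_mono_card[OF finT] T(2) by metis
  \<comment> \<open>\<open>e\<close> lists 0, then \<open>T\<close> in increasing order, then
    \<open>n\<close>; its differences are the parts.\<close>
  define e where "e = (\<lambda>b. if b = 0 then 0 else if b < L then h (b - 1) else n)"
  have h_in: "h b \<in> {1..<n}" if "b < L - 1" for b
    using bij_betw_apply[OF h(1), of b] that T(1) by auto
  have e_less: "e a < e (Suc a)" if "a < L" for a
  proof -
    have "Suc a < L \<or> Suc a = L" using that by auto
    then consider "a = 0" "Suc a < L" | "a = 0" "Suc a = L" | "a > 0" "Suc a < L" | "a > 0" "Suc a = L"
      by (cases "a = 0") auto
    thus ?thesis
    proof cases
      case 1
      thus ?thesis using h_in[of 0] by (simp add: e_def)
    next
      case 2
      thus ?thesis using assms by (simp add: e_def)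
    next
      case 3
      hence "h (a - 1) < h a" by (intro strict_mono_onD[OF h(2)]) auto
      thus ?thesis using 3 by (simp add: e_def)
    next
      case 4
      thus ?thesis using h_in[of "a - 1"] by (simp add: e_def)
    qed
  qed
  define c where "c = (\<lambda>a. if a < L then e (Suc a) - e a else 0)"
  have off: "off c b = e b" if "b \<le> L" for b
    using that
  proof (induction b)
    case 0
    thus ?case by (simp add: e_def)
  next
    case (Suc b)
    thus ?case using e_less[of b] by (simp add: off_Suc c_def)
  qed
  have "sum c {..<L} = n" using off[of L] assms by (simp add: off_def e_def)
  hence "c \<in> comps L n"
    using e_less by (auto simp: comps_def vectors_def c_def)
  moreover have "cuts L c = T"
  proof -
    have "cuts L c = e ` {1..<L}" unfolding cuts_def using off by (intro image_cong) auto
    also have "\<dots> = (\<lambda>b. h (b - 1)) ` {1..<L}" by (intro image_cong) (auto simp: e_def)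
    also have "\<dots> = h ` (\<lambda>b. b - 1) ` {1..<L}" by (simp add: image_image)
    also have "(\<lambda>b. b - 1) ` {1..<L} = {..<L - 1}"
    proof (intro equalityI subsetI)
      fix b assume "b \<in> {..<L - 1}"
      thus "b \<in> (\<lambda>b. b - 1) ` {1..<L}" by (intro image_eqI[of _ _ "Suc b"]) auto
    qed auto
    finally show ?thesis using h(1) by (simp add: bij_betw_def)
  qed
  ultimately show ?thesis by blast
qed

text \<open>Such a superset is fixed by its \<open>k\<close> elements outside
  \<open>B\<close>.\<close>

lemma card_supersets:
  assumes "finite N" "B \<subseteq> N"
  shows "card {T. T \<subseteq> N \<and> card T = card B + k \<and> B \<subseteq> T} = (card N - card B) choose k"
proof -
  have fin: "finite B" using assms finite_subset by blast
  have "bij_betw (\<lambda>S. S \<union> B) {S. S \<subseteq> N - B \<and> card S = k} {T. T \<subseteq> N \<and> card T = card B + k \<and> B \<subseteq> T}"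
  proof (rule bij_betw_byWitness[where f' = "\<lambda>T. T - B"])
    show "(\<lambda>S. S \<union> B) ` {S. S \<subseteq> N - B \<and> card S = k} \<subseteq> {T. T \<subseteq> N \<and> card T = card B + k \<and> B \<subseteq> T}"
    proof (intro subsetI, elim imageE)
      fix T S assume S: "S \<in> {S. S \<subseteq> N - B \<and> card S = k}" and T: "T = S \<union> B"
      have "finite S" using S assms(1) by (auto intro: finite_subset)
      hence "card T = card S + card B" unfolding T using S fin by (intro card_Un_disjoint) auto
      thus "T \<in> {T. T \<subseteq> N \<and> card T = card B + k \<and> B \<subseteq> T}" using S T assms(2) by auto
    qed
    show "(\<lambda>T. T - B) ` {T. T \<subseteq> N \<and> card T = card B + k \<and> B \<subseteq> T} \<subseteq> {S. S \<subseteq> N - B \<and> card S = k}"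
      using fin by (auto simp: card_Diff_subset)
  qed auto
  hence "card {T. T \<subseteq> N \<and> card T = card B + k \<and> B \<subseteq> T} = card {S. S \<subseteq> N - B \<and> card S = k}"
    by (simp add: bij_betw_same_card)
  also have "\<dots> = (card N - card B) choose k"
    using assms fin by (simp add: n_subsets card_Diff_subset)
  finally show ?thesis .
qed

text \<open>Compositions into \<open>L\<close> parts correspond to cut sets of size
  \<open>L - 1\<close>, so supersets of \<open>B\<close> are counted.\<close>

lemma card_comps_cuts:
  assumes "L > 0" "n > 0" "B \<subseteq> {1..<n}"
  shows "card {c\<in>comps L n. B \<subseteq> cuts L c} =
    (if card B < L then (n - 1 - card B) choose (L - 1 - card B) else 0)"
proof -
  have "bij_betw (cuts L) {c\<in>comps L n. B \<subseteq> cuts L c} {T. T \<subseteq> {1..<n} \<and> card T = L - 1 \<and> B \<subseteq> T}"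
    unfolding bij_betw_def
  proof (intro conjI equalityI subsetI)
    show "inj_on (cuts L) {c\<in>comps L n. B \<subseteq> cuts L c}"
      using cuts_inj by (rule inj_on_subset) auto
  next
    fix T assume "T \<in> cuts L ` {c\<in>comps L n. B \<subseteq> cuts L c}"
    thus "T \<in> {T. T \<subseteq> {1..<n} \<and> card T = L - 1 \<and> B \<subseteq> T}" using cuts_in by blast
  next
    fix T assume "T \<in> {T. T \<subseteq> {1..<n} \<and> card T = L - 1 \<and> B \<subseteq> T}"
    thus "T \<in> cuts L ` {c\<in>comps L n. B \<subseteq> cuts L c}"
      using cuts_surj[OF assms(1,2), of T] by blast
  qed
  hence "card {c\<in>comps L n. B \<subseteq> cuts L c} = card {T. T \<subseteq> {1..<n} \<and> card T = L - 1 \<and> B \<subseteq> T}"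
    by (rule bij_betw_same_card)
  also have "\<dots> = (if card B < L then (n - 1 - card B) choose (L - 1 - card B) else 0)"
  proof (cases "card B < L")
    case True
    hence "L - 1 = card B + (L - 1 - card B)" by simp
    thus ?thesis using card_supersets[of "{1..<n}" B "L - 1 - card B"] assms(3) True by simp
  next
    case False
    have "{T. T \<subseteq> {1..<n} \<and> card T = L - 1 \<and> B \<subseteq> T} = {}"
    proof (intro equals0I)
      fix T assume T: "T \<in> {T. T \<subseteq> {1..<n} \<and> card T = L - 1 \<and> B \<subseteq> T}"
      hence "finite T" using finite_subset by blast
      hence "card B \<le> card T" using T by (intro card_mono) auto
      thus False using T False assms(1) by auto
    qed
    thus ?thesis using False by (simp only: card.empty if_False)
  qed
  finally show ?thesis .
qed

section \<open>Breaks of a derangement\<close>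

definition breaks :: "nat \<Rightarrow> (nat \<Rightarrow> nat) \<Rightarrow> nat set" where
  "breaks n p = {i\<in>{1..<n}. p i > p (Suc i) \<or> (p i < i \<and> p (Suc i) > Suc i)}"

lemma derangements_D:
  assumes "p \<in> derangements n"
  shows "p permutes {1..n}" "i \<in> {1..n} \<Longrightarrow> p i \<in> {1..n}" "i \<in> {1..n} \<Longrightarrow> p i \<noteq> i"
  using assms permutes_in_image[of p "{1..n}" i] by (auto simp: derangements_def)

lemma finite_derangements: "finite (derangements n)"
  by (rule finite_subset[OF _ finite_permutations[of "{1..n}"]]) (auto simp: derangements_def)

text \<open>Without a fixed point at \<open>Suc i\<close> the inequality
  \<open>Suc i \<ge> p (Suc i)\<close> is strict, so a crossing descent is a descent. This bounds
  the exponents of \<open>s\<close> by \<open>m\<close>.\<close>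

lemma xdes_le_des:
  assumes "p \<in> derangements n"
  shows "xdes n p \<le> des n p"
  unfolding xdes_def des_def
proof (rule card_mono)
  show "{i\<in>{1..<n}. p i \<ge> Suc i \<and> Suc i \<ge> p (Suc i)} \<subseteq> {i\<in>{1..<n}. p i > p (Suc i)}"
  proof
    fix i assume i: "i \<in> {i\<in>{1..<n}. p i \<ge> Suc i \<and> Suc i \<ge> p (Suc i)}"
    hence "p (Suc i) \<noteq> Suc i" by (intro derangements_D(3)[OF assms]) auto
    thus "i \<in> {i\<in>{1..<n}. p i > p (Suc i)}" using i by auto
  qed
qed simp

lemma card_breaks:
  assumes p: "p \<in> derangements n" and n: "n > 0"
  shows "card (breaks n p) + 1 = des n p + xdes n p" "xdes n p > 0"
proof -
  define NP where "NP = {i\<in>{1..<n}. p i < i \<and> p (Suc i) > Suc i}"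
  define PN where "PN = {i\<in>{1..<n}. p i \<ge> Suc i \<and> Suc i \<ge> p (Suc i)}"
  define s :: "nat \<Rightarrow> int" where "s = (\<lambda>i. of_bool (p i > i))"
  \<comment> \<open>Without fixed points, \<open>PN\<close> consists of the steps from excedance to
    non-excedance and \<open>NP\<close> of the steps back; summing the differences of
    \<open>s\<close> telescopes.\<close>
  have sign_change: "s i - s (Suc i) = of_bool (i \<in> PN) - of_bool (i \<in> NP)" if "i \<in> {1..<n}" for i
  proof -
    have "p i \<noteq> i" "p (Suc i) \<noteq> Suc i"
      by (rule derangements_D(3)[OF p]; use that in simp)+
    thus ?thesis using that by (auto simp: s_def PN_def NP_def)
  qed
  have "(\<Sum>i\<in>{1..<n}. s i - s (Suc i)) = s 1 - s n"
    using n sum_Suc_diff'[of 1 n "\<lambda>i. - s i"] by (simp add: sum_subtractf)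
  moreover have "s 1 = 1"
    using derangements_D(2,3)[OF p, of 1] n by (auto simp: s_def)
  moreover have "s n = 0"
    using derangements_D(2)[OF p, of n] n by (auto simp: s_def)
  moreover have "(\<Sum>i\<in>{1..<n}. s i - s (Suc i)) = (\<Sum>i\<in>{1..<n}. of_bool (i \<in> PN) - of_bool (i \<in> NP))"
    by (rule sum.cong) (use sign_change in auto)
  moreover have "\<dots> = int (card PN) - int (card NP)"
  proof -
    have "(\<Sum>i\<in>{1..<n}. of_bool (i \<in> S)) = int (card S)" if "S \<subseteq> {1..<n}" for S
    proof -
      have "{1..<n} \<inter> S = S" using that by auto
      thus ?thesis by (simp add: sum.If_cases of_bool_def)
    qed
    moreover have "PN \<subseteq> {1..<n}" "NP \<subseteq> {1..<n}" by (auto simp: PN_def NP_def)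
    ultimately show ?thesis by (simp only: sum_subtractf)
  qed
  \<comment> \<open>the excedance indicator is 1 at the first position and 0 at the last, so up-to-down changes
     outnumber down-to-up changes by one\<close>
  ultimately have PN: "card PN = card NP + 1" by linarith
  thus "xdes n p > 0" by (simp add: xdes_def PN_def)
  \<comment> \<open>A step in \<open>NP\<close> is an ascent, so the union is disjoint.\<close>
  have "breaks n p = {i\<in>{1..<n}. p i > p (Suc i)} \<union> NP"
    by (auto simp: breaks_def NP_def)
  moreover have "{i\<in>{1..<n}. p i > p (Suc i)} \<inter> NP = {}"
    by (auto simp: NP_def)
  ultimately have "card (breaks n p) = des n p + card NP"
    by (simp add: des_def card_Un_disjoint NP_def)
  thus "card (breaks n p) + 1 = des n p + xdes n p"
    using PN by (simp add: xdes_def PN_def)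
qed

section \<open>Derangements whose breaks lie among given cuts\<close>

lemma seg_Suc_not_cut:
  assumes c: "c \<in> comps L n" and i: "i \<in> {1..<n}" "i \<notin> cuts L c"
  shows "seg c (Suc i) = seg c i"
proof (rule seg_eqI)
  have c': "c \<in> vectors {..<L} n" using c by (simp add: comps_def)
  have i': "i \<in> {1..n}" using i by auto
  note b = seg_bounds[OF c' i']
  show "off c (seg c i) < Suc i" using b by simp
  have "i \<noteq> off c (Suc (seg c i))"
  proof
    assume eq: "i = off c (Suc (seg c i))"
    have "Suc (seg c i) \<noteq> L" using eq i off_length[OF c'] by auto
    hence "Suc (seg c i) \<in> {1..<L}" using b by auto
    thus False using i(2) eq by (auto simp: cuts_def)
  qed
  thus "Suc i \<le> off c (Suc (seg c i))" using b by simp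
qed

lemma seg_off:
  assumes c: "c \<in> comps L n" and a: "Suc a < L"
  shows "seg c (off c (Suc a)) = a" "seg c (Suc (off c (Suc a))) = Suc a"
    "off c (Suc a) \<in> {1..<n}" "off c (Suc a) \<in> cuts L c"
proof -
  have "off c a < off c (Suc a)" "off c (Suc a) < off c (Suc (Suc a))"
    using off_strict_mono[OF c] a by auto
  thus "seg c (off c (Suc a)) = a" "seg c (Suc (off c (Suc a))) = Suc a"
    by (auto intro!: seg_eqI)
  show "off c (Suc a) \<in> cuts L c" using a by (auto simp: cuts_def)
  thus "off c (Suc a) \<in> {1..<n}" using cuts_in(1)[OF c] by blast
qed

lemma cutsE:
  assumes "i \<in> cuts L c"
  obtains a where "Suc a < L" "i = off c (Suc a)"
proof -
  obtain b where "b \<in> {1..<L}" "i = off c b" using assms by (auto simp: cuts_def)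
  thus ?thesis using that[of "b - 1"] by auto
qed

text \<open>This turns out to be the common value of \<open>xdes\<close> on all permutations in
  \<open>shaped E c n\<close>, for a composition \<open>c\<close> into \<open>L\<close>
  parts.\<close>

definition sign_drops :: "nat \<Rightarrow> nat set \<Rightarrow> nat" where
  "sign_drops L E = card {a. Suc a < L \<and> a \<in> E \<and> Suc a \<notin> E}"

lemma shaped_step:
  assumes p: "p \<in> shaped E c n" and i: "i \<in> {1..n}"
  shows "i < p i \<longleftrightarrow> seg c i \<in> E" "p i < i \<longleftrightarrow> seg c i \<notin> E"
  using p i by (auto simp: shaped_def split: if_splits dest!: bspec[of _ _ i])

lemma shaped_derangement:
  assumes p: "p \<in> shaped E c n"
  shows "p \<in> derangements n"
proof -
  have "p i \<noteq> i" if "i \<in> {1..n}" for i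
    using shaped_step[OF p that] by auto
  thus ?thesis using p by (simp add: derangements_def shaped_def)
qed

text \<open>Inside a segment \<open>p\<close> increases and keeps its sign, so neither kind of break
  occurs there.\<close>

lemma shaped_breaks:
  assumes c: "c \<in> comps L n" and p: "p \<in> shaped E c n"
  shows "breaks n p \<subseteq> cuts L c"
proof
  fix i assume i: "i \<in> breaks n p"
  show "i \<in> cuts L c"
  proof (rule ccontr)
    assume "i \<notin> cuts L c"
    have i': "i \<in> {1..<n}" "i \<in> {1..n}" "Suc i \<in> {1..n}" using i by (auto simp: breaks_def)
    have seg: "seg c (Suc i) = seg c i"
      using seg_Suc_not_cut[OF c i'(1) \<open>i \<notin> cuts L c\<close>] .
    have "p i < p (Suc i)" using p i' seg by (simp add: shaped_def)
    moreover have "\<not> (p i < i \<and> Suc i < p (Suc i))"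
      using shaped_step[OF p i'(2)] shaped_step[OF p i'(3)] seg by simp
    ultimately show False using i by (auto simp: breaks_def)
  qed
qed

text \<open>A crossing descent is a change from positive to negative sign. It can only occur at a
  cut, and the cut after segment \<open>a\<close> is one exactly if \<open>a \<in> E\<close> and
  \<open>Suc a \<notin> E\<close>.\<close>

lemma shaped_xdes:
  assumes c: "c \<in> comps L n" and p: "p \<in> shaped E c n"
  shows "xdes n p = sign_drops L E"
proof -
  define S where "S = {a. Suc a < L \<and> a \<in> E \<and> Suc a \<notin> E}"
  have "{i\<in>{1..<n}. p i \<ge> Suc i \<and> Suc i \<ge> p (Suc i)} = (\<lambda>a. off c (Suc a)) ` S"
  proof (intro equalityI subsetI)
    fix i assume i: "i \<in> {i\<in>{1..<n}. p i \<ge> Suc i \<and> Suc i \<ge> p (Suc i)}"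
    hence i': "i \<in> {1..<n}" "i \<in> {1..n}" "Suc i \<in> {1..n}" by auto
    have E: "seg c i \<in> E" "seg c (Suc i) \<notin> E"
      using i shaped_step(1)[OF p i'(2)] shaped_step(1)[OF p i'(3)] by auto
    hence "i \<in> cuts L c" using seg_Suc_not_cut[OF c i'(1)] by (cases "i \<in> cuts L c") auto
    then obtain a where a: "Suc a < L" "i = off c (Suc a)" by (rule cutsE)
    hence "a \<in> S" using E seg_off[OF c a(1)] by (simp add: S_def)
    thus "i \<in> (\<lambda>a. off c (Suc a)) ` S" using a by simp
  next
    fix i assume "i \<in> (\<lambda>a. off c (Suc a)) ` S"
    then obtain a where a: "a \<in> S" "i = off c (Suc a)" by auto
    hence "Suc a < L" by (simp add: S_def)
    note seg = seg_off[OF c this, folded a(2)]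
    have i': "i \<in> {1..n}" "Suc i \<in> {1..n}" using seg(3) by auto
    show "i \<in> {i\<in>{1..<n}. p i \<ge> Suc i \<and> Suc i \<ge> p (Suc i)}"
      using shaped_step(1)[OF p i'(1)] shaped_step(2)[OF p i'(2)] seg a(1) by (auto simp: S_def)
  qed
  moreover have "inj_on (\<lambda>a. off c (Suc a)) S"
  proof (rule linorder_inj_onI')
    fix a b assume "a \<in> S" "b \<in> S" "a < b"
    thus "off c (Suc a) \<noteq> off c (Suc b)"
      using off_strict_mono[OF c, of "Suc a" "Suc b"] by (simp add: S_def)
  qed
  ultimately show ?thesis
    unfolding xdes_def sign_drops_def S_def[symmetric] by (simp add: card_image)
qed

text \<open>Neighbours in one segment form no break. So \<open>p\<close> ascends and keeps the sign:
  an excedance followed by a larger value is followed by an excedance, and a change from negative to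
  positive would be a break.\<close>

lemma shaped_exists:
  assumes c: "c \<in> comps L n" and p: "p \<in> derangements n" and br: "breaks n p \<subseteq> cuts L c"
  shows "\<exists>E\<in>Pow {..<L}. p \<in> shaped E c n"
proof -
  have c': "c \<in> vectors {..<L} n" using c by (simp add: comps_def)
  \<comment> \<open>The sign of a segment is read off at its first position.\<close>
  define E where "E = {a. a < L \<and> off c a + 1 < p (off c a + 1)}"
  have adj: "p i < p (Suc i) \<and> (i < p i \<longleftrightarrow> Suc i < p (Suc i))"
    if "i \<in> {1..<n}" "seg c i = seg c (Suc i)" for i
  proof -
    have i: "i \<in> {1..n}" "Suc i \<in> {1..n}" using that by auto
    have "i \<notin> cuts L c"
    proof
      assume "i \<in> cuts L c"
      then obtain a where a: "Suc a < L" "i = off c (Suc a)" by (rule cutsE)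
      show False using that(2) seg_off(1,2)[OF c a(1)] unfolding a(2) by simp
    qed
    hence "i \<notin> breaks n p" using br by auto
    moreover have "p i \<noteq> p (Suc i)"
      by (simp add: inj_eq[OF permutes_inj[OF derangements_D(1)[OF p]]])
    moreover note derangements_D(3)[OF p i(1)] derangements_D(3)[OF p i(2)]
    ultimately show ?thesis using that(1) by (auto simp: breaks_def)
  qed
  have seg_between: "seg c k = seg c i"
    if "i \<in> {1..n}" "j \<in> {1..n}" "seg c i = seg c j" "i \<le> k" "k \<le> j" for i j k
  proof -
    have "k \<in> {1..n}" using that by auto
    thus ?thesis using seg_mono[OF c', of i k] seg_mono[OF c', of k j] that by linarith
  qed
  have chain: "(i = j \<or> p i < p j) \<and> (i < p i \<longleftrightarrow> j < p j)"
    if "i \<le> j" "i \<in> {1..n}" "j \<in> {1..n}" "seg c i = seg c j" for i j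
    using that
  proof (induction j rule: dec_induct)
    case (step k)
    have k: "k \<in> {1..<n}" "k \<in> {1..n}" using step by auto
    have "seg c k = seg c i"
      using seg_between[OF step.prems(1,2,3), of k] step.hyps by simp
    hence "(i = k \<or> p i < p k) \<and> (i < p i \<longleftrightarrow> k < p k)"
      "p k < p (Suc k) \<and> (k < p k \<longleftrightarrow> Suc k < p (Suc k))"
      using step.IH step.prems k adj[of k] by simp_all
    thus ?case by auto
  qed simp
  have "p \<in> shaped E c n"
    unfolding shaped_def mem_Collect_eq
  proof (intro conjI ballI impI)
    show "p permutes {1..n}" using derangements_D(1)[OF p] .
    show "p i < p j" if "i \<in> {1..n}" "j \<in> {1..n}" "i < j \<and> seg c i = seg c j" for i j
      using chain[of i j] that by auto
    fix i assume i: "i \<in> {1..n}"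
    note b = seg_bounds[OF c' i]
    define i0 where "i0 = off c (seg c i) + 1"
    have i0: "i0 \<in> {1..n}" "seg c i0 = seg c i" "i0 \<le> i"
      using in_segI[OF c', of "seg c i" i0] b by (auto simp: i0_def)
    have "i0 < p i0 \<longleftrightarrow> i < p i" using chain[OF i0(3,1) i i0(2)] by simp
    hence "seg c i \<in> E \<longleftrightarrow> i < p i" using b by (simp add: E_def i0_def)
    thus "if seg c i \<in> E then i < p i else p i < i"
      using derangements_D(3)[OF p i] by auto
  qed
  thus ?thesis by (intro bexI[of _ E]) (auto simp: E_def)
qed

text \<open>Each segment of a composition is nonempty, and its first position reveals whether it
  belongs to the sign set.\<close>

lemma shaped_unique:
  assumes c: "c \<in> comps L n" and E: "E \<subseteq> {..<L}" "E' \<subseteq> {..<L}"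
    and p: "p \<in> shaped E c n" "p \<in> shaped E' c n"
  shows "E = E'"
proof -
  have c': "c \<in> vectors {..<L} n" using c by (simp add: comps_def)
  have "a \<in> E \<longleftrightarrow> a \<in> E'" if a: "a < L" for a
  proof -
    have i: "off c a + 1 \<in> {1..n}" "seg c (off c a + 1) = a"
      using in_segI[OF c', of a "off c a + 1"] off_strict_mono[OF c, of a "Suc a"] a by auto
    show ?thesis using shaped_step(1)[OF p(1) i(1)] shaped_step(1)[OF p(2) i(1)] i(2) by simp
  qed
  thus ?thesis using E by blast
qed

section \<open>Rationality\<close>

definition refined :: "nat \<Rightarrow> nat \<Rightarrow> nat \<Rightarrow> nat" where
  "refined m k n = card {p \<in> derangements n. des n p = m \<and> xdes n p = k}"

lemma xdes_0 [simp]: "xdes 0 p = 0"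
  by (simp add: xdes_def)

text \<open>The \<open>m + k - 1\<close> breaks are elements of \<open>{1..<n}\<close>, which forces
  \<open>n \<ge> m + k\<close>.\<close>

lemma refined_eq_0:
  assumes "k > 0" "n < m + k"
  shows "refined m k n = 0"
proof -
  have "{p \<in> derangements n. des n p = m \<and> xdes n p = k} = {}"
  proof (intro equals0I)
    fix p assume p: "p \<in> {p \<in> derangements n. des n p = m \<and> xdes n p = k}"
    \<comment> \<open>For \<open>n = 0\<close> there are no crossing descents, contrary to
      \<open>k > 0\<close>.\<close>
    hence n: "n > 0" using assms(1) by (intro gr0I) auto
    have "card (breaks n p) \<le> card {1..<n}"
      by (rule card_mono) (auto simp: breaks_def)
    moreover have "card (breaks n p) + 1 = m + k"
      using card_breaks(1)[OF _ n, of p] p by simp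
    ultimately show False using assms(2) n by simp
  qed
  thus ?thesis by (simp only: refined_def card.empty)
qed

text \<open>A derangement whose breaks are all cuts has exactly one sign set \<open>E\<close>, and
  \<open>xdes\<close> is the number of sign drops of \<open>E\<close>.\<close>

lemma sum_card_shaped:
  assumes c: "c \<in> comps L n"
  shows "(\<Sum>E\<in>{E\<in>Pow {..<L}. sign_drops L E = k}. card (shaped E c n)) =
    card {p\<in>{p\<in>derangements n. xdes n p = k}. breaks n p \<subseteq> cuts L c}"
proof -
  define Es where "Es = {E\<in>Pow {..<L}. sign_drops L E = k}"
  have fin: "finite (shaped E c n)" for E
    using finite_derangements[of n] shaped_derangement[of _ E c n] by (meson finite_subset subsetI)
  have "{p\<in>{p\<in>derangements n. xdes n p = k}. breaks n p \<subseteq> cuts L c} = (\<Union>E\<in>Es. shaped E c n)"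
  proof (intro equalityI subsetI)
    fix p assume p: "p \<in> {p\<in>{p\<in>derangements n. xdes n p = k}. breaks n p \<subseteq> cuts L c}"
    then obtain E where E: "E \<in> Pow {..<L}" "p \<in> shaped E c n"
      using shaped_exists[OF c, of p] by auto
    moreover have "sign_drops L E = k" using shaped_xdes[OF c E(2)] p by simp
    ultimately show "p \<in> (\<Union>E\<in>Es. shaped E c n)" by (auto simp: Es_def)
  next
    fix p assume "p \<in> (\<Union>E\<in>Es. shaped E c n)"
    then obtain E where E: "E \<in> Es" "p \<in> shaped E c n" by auto
    show "p \<in> {p\<in>{p\<in>derangements n. xdes n p = k}. breaks n p \<subseteq> cuts L c}"
      using shaped_derangement[OF E(2)] shaped_xdes[OF c E(2)] shaped_breaks[OF c E(2)] E(1)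
      by (simp add: Es_def)
  qed
  also have "card \<dots> = (\<Sum>E\<in>Es. card (shaped E c n))"
  proof (rule card_UN_disjoint)
    show "\<forall>E\<in>Es. \<forall>E'\<in>Es. E \<noteq> E' \<longrightarrow> shaped E c n \<inter> shaped E' c n = {}"
      using shaped_unique[OF c] by (auto simp: Es_def)
  qed (use fin in \<open>auto simp: Es_def\<close>)
  finally show ?thesis by (simp only: Es_def)
qed

lemma sum_card_swap:
  assumes "finite A" "finite B"
  shows "(\<Sum>a\<in>A. card {b\<in>B. P a b}) = (\<Sum>b\<in>B. card {a\<in>A. P a b})"
  using sum.swap_restrict[OF assms, of "\<lambda>_ _. 1 :: nat" P] by simp

text \<open>Double counting of pairs. A derangement with \<open>des = j\<close> has
  \<open>j + k - 1\<close> breaks; completing them to \<open>m + k - 1\<close> cuts means choosing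
  \<open>m - j\<close> of the other \<open>n - (j + k)\<close> elements of
  \<open>{1..<n}\<close>.\<close>

lemma sum_full_balanced:
  assumes k: "k > 0"
  shows "(\<Sum>E\<in>{E\<in>Pow {..<m + k}. sign_drops (m + k) E = k}. full_balanced (allowed E) {..<m + k} n) =
    (\<Sum>j\<le>m. ((n - (j + k)) choose (m - j)) * refined j k n)"
proof (cases "n = 0")
  case True
  \<comment> \<open>The count of breaks requires \<open>n > 0\<close>. For \<open>n = 0\<close> both
    sides vanish, as 0 has no composition into \<open>m + k > 0\<close> positive parts.\<close>
  have "comps (m + k) 0 = {}"
  proof (intro equals0I)
    fix c assume c: "c \<in> comps (m + k) 0"
    hence "c 0 > 0" using k by (simp add: comps_def)
    moreover have "c 0 \<le> sum c {..<m + k}" by (rule member_le_sum) (use k in auto)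
    moreover have "sum c {..<m + k} = 0" using c unfolding comps_def vectors_def by blast
    ultimately show False by linarith
  qed
  hence "full_balanced (allowed E) {..<m + k} 0 = 0" for E
    unfolding full_balanced_def comps_def[symmetric] by simp
  moreover have "refined j k 0 = 0" for j using refined_eq_0[of k 0 j] k by simp
  ultimately show ?thesis using True by simp
next
  case False
  define L where "L = m + k"
  define Es where "Es = {E\<in>Pow {..<L}. sign_drops L E = k}"
  define D where "D = {p\<in>derangements n. xdes n p = k}"
  have n: "n > 0" and L: "L > 0" using False k by (auto simp: L_def)
  have finC: "finite (comps L n)" using finite_vectors[of "{..<L}" n] by (simp add: comps_def)
  have finD: "finite D" using finite_derangements by (simp add: D_def)
  have "(\<Sum>E\<in>Es. full_balanced (allowed E) {..<L} n) = (\<Sum>E\<in>Es. \<Sum>c\<in>comps L n. card (shaped E c n))"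
    unfolding full_balanced_def comps_def[symmetric]
    by (intro sum.cong refl card_shaped[symmetric]) (auto simp: comps_def)
  also have "\<dots> = (\<Sum>c\<in>comps L n. \<Sum>E\<in>Es. card (shaped E c n))"
    by (rule sum.swap)
  also have "\<dots> = (\<Sum>c\<in>comps L n. card {p\<in>D. breaks n p \<subseteq> cuts L c})"
    unfolding Es_def D_def by (intro sum.cong refl sum_card_shaped)
  also have "\<dots> = (\<Sum>p\<in>D. card {c\<in>comps L n. breaks n p \<subseteq> cuts L c})"
    using finC finD by (rule sum_card_swap)
  also have "\<dots> = (\<Sum>p\<in>D. if des n p \<in> {..m} then (n - (des n p + k)) choose (m - des n p) else 0)"
  proof (rule sum.cong)
    fix p assume "p \<in> D"
    hence "card (breaks n p) + 1 = des n p + k"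
      using card_breaks(1)[OF _ n, of p] by (simp add: D_def)
    hence *: "card (breaks n p) < L \<longleftrightarrow> des n p \<in> {..m}"
      "n - 1 - card (breaks n p) = n - (des n p + k)"
      "L - 1 - card (breaks n p) = m - des n p"
      using k by (auto simp: L_def)
    have "breaks n p \<subseteq> {1..<n}" by (auto simp: breaks_def)
    from card_comps_cuts[OF L n this] show "card {c\<in>comps L n. breaks n p \<subseteq> cuts L c} =
        (if des n p \<in> {..m} then (n - (des n p + k)) choose (m - des n p) else 0)"
      by (simp only: *)
  qed simp
  also have "\<dots> = (\<Sum>p\<in>{p\<in>D. des n p \<in> {..m}}. (n - (des n p + k)) choose (m - des n p))"
    using finD by (simp only: sum.inter_filter)
  also have "\<dots> = (\<Sum>j\<le>m. \<Sum>p\<in>{p\<in>{p\<in>D. des n p \<in> {..m}}. des n p = j}.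
      (n - (des n p + k)) choose (m - des n p))"
    using finD by (intro sum.group[symmetric]) auto
  also have "\<dots> = (\<Sum>j\<le>m. ((n - (j + k)) choose (m - j)) * refined j k n)"
  proof (rule sum.cong)
    fix j assume j: "j \<in> {..m}"
    have "{p\<in>{p\<in>D. des n p \<in> {..m}}. des n p = j} = {p \<in> derangements n. des n p = j \<and> xdes n p = k}"
      using j by (auto simp: D_def)
    thus "(\<Sum>p\<in>{p\<in>{p\<in>D. des n p \<in> {..m}}. des n p = j}. (n - (des n p + k)) choose (m - des n p)) =
        ((n - (j + k)) choose (m - j)) * refined j k n"
      by (simp add: refined_def)
  qed simp
  finally show ?thesis by (simp only: L_def Es_def)
qed

lemma rational_refined:
  assumes k: "k > 0"
  shows "rational_fraction_su (Abs_fps (\<lambda>n. of_nat (refined m k n)))"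
proof (induction m rule: less_induct)
  case (less m)
  define Es where "Es = {E\<in>Pow {..<m + k}. sign_drops (m + k) E = k}"
  define G :: "nat \<Rightarrow> int poly fps" where
    "G = (\<lambda>j. Abs_fps (\<lambda>n. of_nat ((n - (j + k)) choose (m - j)) * of_nat (refined j k n)))"
  have "rational_fraction_su ((\<Sum>E\<in>Es. Abs_fps (\<lambda>n. of_nat (full_balanced (allowed E) {..<m + k} n))) -
      (\<Sum>j<m. G j))"
  proof (intro rational_diff rational_sum rational_full_balanced)
    fix j assume "j \<in> {..<m}"
    thus "rational_fraction_su (G j)"
      \<comment> \<open>\<open>refined j k\<close> vanishes below \<open>j + k\<close>, as the
        truncated difference in the binomial requires.\<close>
      unfolding G_def using refined_eq_0[OF k]
      by (intro rational_mult_binomial less.IH) auto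
  qed simp
  also have "(\<Sum>E\<in>Es. Abs_fps (\<lambda>n. of_nat (full_balanced (allowed E) {..<m + k} n))) - (\<Sum>j<m. G j) =
      Abs_fps (\<lambda>n. of_nat (refined m k n))"
  proof (rule fps_ext)
    fix n
    have "(\<Sum>E\<in>Es. full_balanced (allowed E) {..<m + k} n) =
        (\<Sum>j<m. ((n - (j + k)) choose (m - j)) * refined j k n) + refined m k n"
      unfolding Es_def sum_full_balanced[OF k] lessThan_Suc_atMost[symmetric] by simp
    hence "(of_nat (\<Sum>E\<in>Es. full_balanced (allowed E) {..<m + k} n) :: int poly) =
        of_nat (\<Sum>j<m. ((n - (j + k)) choose (m - j)) * refined j k n) + of_nat (refined m k n)"
      by (simp only: of_nat_add)
    thus "fps_nth ((\<Sum>E\<in>Es. Abs_fps (\<lambda>n. of_nat (full_balanced (allowed E) {..<m + k} n))) -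
        (\<Sum>j<m. G j)) n = fps_nth (Abs_fps (\<lambda>n. of_nat (refined m k n))) n"
      by (simp add: fps_sum_nth G_def)
  qed
  finally show ?case .
qed

theorem theorem3p1:
  fixes m :: nat
  shows "rational_fraction_su (F_coeff m)"
proof -
  \<comment> \<open>Split by the value \<open>k\<close> of \<open>xdes\<close>, which lies between 1
    and \<open>m\<close> for a derangement with \<open>n > 0\<close> and \<open>des = m\<close>. The
    coefficient at \<open>n = 0\<close> is added separately, since the empty permutation has no
    crossing descent.\<close>
  have "F_coeff m = fps_const (fps_nth (F_coeff m) 0) +
      (\<Sum>k\<in>{1..m}. fps_const (monom 1 k) * Abs_fps (\<lambda>n. of_nat (refined m k n)))"
    (is "_ = _ + ?S")
  proof (rule fps_ext)
    fix n
    define D where "D = {p\<in>derangements n. des n p = m}"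
    have S: "fps_nth ?S n = (\<Sum>k\<in>{1..m}. monom 1 k * of_nat (refined m k n))"
      by (simp add: fps_sum_nth)
    show "fps_nth (F_coeff m) n = fps_nth (fps_const (fps_nth (F_coeff m) 0) + ?S) n"
    proof (cases "n = 0")
      case True
      have "fps_nth ?S n = 0"
        unfolding S by (intro sum.neutral) (use True in \<open>auto simp: refined_eq_0\<close>)
      thus ?thesis using True by simp
    next
      case False
      have xdes: "xdes n p \<in> {1..m}" if "p \<in> D" for p
        using xdes_le_des[of p n] card_breaks(2)[of p n] that False by (simp add: D_def)
      \<comment> \<open>At \<open>n = 1\<close> every \<open>xdes\<close> is 0, outside
        \<open>{1..m}\<close>; so no derangement exists, in agreement with the default 0 in
        \<open>F_coeff\<close>.\<close>
      have "D = {}" if "n < 2"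
      proof -
        have "n = 1" using that False by simp
        thus ?thesis using xdes by (force simp: xdes_def)
      qed
      moreover have "fps_nth (F_coeff m) n = (if n < 2 then 0 else \<Sum>p\<in>D. monom 1 (xdes n p))"
        using False by (simp add: F_coeff_def D_def)
      ultimately have "fps_nth (F_coeff m) n = (\<Sum>p\<in>D. monom 1 (xdes n p))" by simp
      also have "\<dots> = (\<Sum>k\<in>{1..m}. \<Sum>p\<in>{p\<in>D. xdes n p = k}. monom 1 (xdes n p))"
        using finite_derangements xdes by (intro sum.group[symmetric]) (auto simp: D_def)
      also have "\<dots> = (\<Sum>k\<in>{1..m}. monom 1 k * of_nat (refined m k n))"
      proof (rule sum.cong)
        fix k
        have "{p\<in>D. xdes n p = k} = {p \<in> derangements n. des n p = m \<and> xdes n p = k}"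
          by (auto simp: D_def)
        thus "(\<Sum>p\<in>{p\<in>D. xdes n p = k}. monom 1 (xdes n p)) = monom 1 k * of_nat (refined m k n)"
          by (simp add: refined_def mult.commute)
      qed simp
      finally show ?thesis using False S by simp
    qed
  qed
  moreover have "rational_fraction_su (fps_const (fps_nth (F_coeff m) 0) +
      (\<Sum>k\<in>{1..m}. fps_const (monom 1 k) * Abs_fps (\<lambda>n. of_nat (refined m k n))))"
    by (intro rational_add rational_sum rational_mult rational_refined) auto
  ultimately show ?thesis by (rule ssubst)
qed

end
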